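(* Let $n,r$ be natural numbers with $r\le n$, let $\ell:=\min\{n,2r\}$, and let $\delta\in[0,1)$ be given. Consider the following system of conditions (C) on a constant $\alpha\in(1-\delta,(1+\delta)/2]$, a diagonal matrix $\Sigma\in\mathbb{R}^{r\times r}$, a diagonal matrix $\Lambda\in\mathbb{R}^{(\ell-r)\times(\ell-r)}$ and matrices $A\in\mathbb{R}^{r\times r}$, $C\in\mathbb{R}^{(\ell-r)\times r}$: \begin{align*} &(1+\delta)\min_{1\le i\le r}\Sigma_{ii}\ \ge\ \max_{1\le i\le \ell-r}\Lambda_{ii},\qquad \Sigma\succ0,\\ &\langle\Lambda,CC^T\rangle=\alpha\left[\mathrm{tr}(\Sigma^2)-2\langle\Sigma,AA^T\rangle+\|AA^T\|_F^2+2\|AC^T\|_F^2+\|CC^T\|_F^2\right],\\ &\mathrm{tr}(\Lambda^2)\le\alpha^{-1}(2\alpha-1+\delta^2)\cdot\langle\Lambda,CC^T\rangle,\qquad \langle\Lambda,CC^T\rangle\ne0. \end{align*} (Necessity) There exists a function $f_s$ with the $\delta$-RIP$_{2r,2r}$ property such that the problem $\min_{U\in\mathbb{R}^{n\times r}}f_s(UU^T)$ has a spurious second-order critical point only if there exist a constant $\alpha\in(1-\delta,(1+\delta)/2]$, a diagonal matrix $\Sigma\in\mathbb{R}^{r\times r}$, a diagonal matrix $\Lambda\in\mathbb{R}^{(\ell-r)\times(\ell-r)}$ and matrices $A\in\mathbb{R}^{r\times r}$, $C\in\mathbb{R}^{(\ell-r)\times r}$ satisfying (C). (Sufficiency) If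 there exist a constant $\alpha\in(1-\delta,(1+\delta)/2]$, a diagonal matrix $\Sigma\in\mathbb{R}^{r\times r}$, a diagonal matrix $\Lambda\in\mathbb{R}^{(\ell-r)\times(\ell-r)}$ and matrices $A\in\mathbb{R}^{r\times r}$, $C\in\mathbb{R}^{(\ell-r)\times r}$ satisfying (C) and, in addition, $AC^T=0$, then there exists a function $f_s$ with the $\delta$-RIP$_{2r,2r}$ property for which the problem $\min_{U\in\mathbb{R}^{n\times r}}f_s(UU^T)$ has a spurious second-order critical point.
   Context: All functions $f_s:\mathbb{R}^{n\times n}\to\mathbb{R}$ are twice continuously differentiable, and (without loss of generality, by replacing $f_s(M)$ with $\frac12[f_s(M)+f_s(M^T)]$) $\nabla f_s(M)$ is assumed symmetric. Standing assumption: $f_s$ has a first-order critical point $M_s^*$ (i.e. $\nabla f_s(M_s^* )=0$) that is symmetric, positive semidefinite and of rank at most $r$. $\delta$-RIP$_{2r,2r}$: $(1-\delta)\|K\|_F^2\le[\nabla^2f_s(M)](K,K)\le(1+\delta)\|K\|_F^2$ for all $M,K\in\mathbb{R}^{n\times n}$ of rank at most $2r$. A second-order critical point of an unconstrained problem is a point where the gradient of the objective vanishes and its Hessian is positive semidefinite; it is spurious if it is not a global minimizer. $\langle X,Y\rangle=\mathrm{tr}(X^TY)$. $\Lambda$ is not required to be positive semidefinite. If $\ell=r$, the maximum over the empty index set is vacuous. *)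

theory Defs
  imports "HOL-Analysis.Analysis" "Jordan_Normal_Form.Matrix"
begin

text \<open>
  The objective lives on \<open>real^'n^'n\<close>, whose library inner product and norm are the
  Frobenius ones (lemma \<open>inner_eq_trace\<close> below). The small matrices of the system of
  conditions are values of type \<open>real mat\<close>, because the dimension \<open>\<ell> - r\<close> may be zero
  and hence is not the cardinality of a type.
\<close>

lemma inner_eq_trace:
  fixes X Y :: "real^'n^'m"
  shows "inner X Y = trace (Finite_Cartesian_Product.transpose X ** Y)"
  by (simp add: inner_vec_def trace_def matrix_matrix_mult_def
      Finite_Cartesian_Product.transpose_def) (rule sum.swap)

subsection \<open>Gradient, Hessian and critical points\<close>

text \<open>The value of \<open>grad\<close> is meaningful only at points of differentiability;
  it is used only for functions that are at least continuously differentiable.\<close>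

definition grad :: "('a::real_inner \<Rightarrow> real) \<Rightarrow> 'a \<Rightarrow> 'a" where
  "grad f x = (THE D. GDERIV f x :> D)"

lemma grad_eqI:
  assumes "GDERIV f x :> D"
  shows "grad f x = D"
  unfolding grad_def
proof (rule the_equality[where P = "\<lambda>E. GDERIV f x :> E", OF assms])
  fix E assume "GDERIV f x :> E"
  with assms have "(\<lambda>h. inner h D) = (\<lambda>h. inner h E)"
    unfolding gderiv_def by (intro has_derivative_unique)
  then have "inner (E - D) (E - D) = 0"
    by (metis inner_diff_right right_minus_eq)
  then show "E = D" by simp
qed

definition hessian :: "('a::real_inner \<Rightarrow> real) \<Rightarrow> 'a \<Rightarrow> 'a \<Rightarrow> 'a \<Rightarrow> real" where
  "hessian f x u v = inner (frechet_derivative (grad f) (at x) u) v"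

text \<open>On a Euclidean space, continuity of the second derivative in operator norm is the same
  as pointwise continuity in each direction.\<close>

definition twice_continuously_differentiable :: "('a::euclidean_space \<Rightarrow> real) \<Rightarrow> bool" where
  "twice_continuously_differentiable f \<longleftrightarrow>
     (\<forall>x. f differentiable (at x)) \<and>
     (\<forall>x. grad f differentiable (at x)) \<and>
     (\<forall>u. continuous_on UNIV (\<lambda>x. frechet_derivative (grad f) (at x) u))"

definition first_order_critical :: "('a::euclidean_space \<Rightarrow> real) \<Rightarrow> 'a \<Rightarrow> bool" where
  "first_order_critical h x \<longleftrightarrow> grad h x = 0"

definition second_order_critical :: "('a::euclidean_space \<Rightarrow> real) \<Rightarrow> 'a \<Rightarrow> bool" where
  "second_order_critical h x \<longleftrightarrow> grad h x = 0 \<and> (\<forall>v. 0 \<le> hessian h x v v)"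

definition global_minimizer :: "('a \<Rightarrow> real) \<Rightarrow> 'a \<Rightarrow> bool" where
  "global_minimizer h x \<longleftrightarrow> (\<forall>y. h x \<le> h y)"

definition spurious_second_order_critical :: "('a::euclidean_space \<Rightarrow> real) \<Rightarrow> 'a \<Rightarrow> bool" where
  "spurious_second_order_critical h x \<longleftrightarrow>
     second_order_critical h x \<and> \<not> global_minimizer h x"

subsection \<open>The class of objective functions\<close>

definition symmetric_matrix :: "real^'n^'n \<Rightarrow> bool" where
  "symmetric_matrix M \<longleftrightarrow> Finite_Cartesian_Product.transpose M = M"

definition positive_semidefinite :: "real^'n^'n \<Rightarrow> bool" where
  "positive_semidefinite M \<longleftrightarrow> symmetric_matrix M \<and> (\<forall>x. 0 \<le> inner x (M *v x))"

text \<open>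
  Symmetry of the gradient is required at symmetric points only, which is exactly what the
  replacement of \<open>f M\<close> by \<open>(f M + f M\<^sup>T) / 2\<close> achieves. (A gradient that is symmetric at all
  \<open>M\<close> would force the Hessian to vanish on skew-symmetric directions and so would contradict
  the restricted isometry property when \<open>n \<ge> 2\<close>.)
\<close>

definition admissible_objective :: "nat \<Rightarrow> (real^'n^'n \<Rightarrow> real) \<Rightarrow> bool" where
  "admissible_objective r f \<longleftrightarrow>
     twice_continuously_differentiable f \<and>
     (\<forall>M. symmetric_matrix M \<longrightarrow> symmetric_matrix (grad f M)) \<and>
     (\<exists>M. first_order_critical f M \<and> symmetric_matrix M \<and> positive_semidefinite M \<and> rank M \<le> r)"

definition RIP :: "real \<Rightarrow> nat \<Rightarrow> nat \<Rightarrow> (real^'n^'n \<Rightarrow> real) \<Rightarrow> bool" where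
  "RIP \<delta> p q f \<longleftrightarrow>
     (\<forall>M K. rank M \<le> p \<longrightarrow> rank K \<le> q \<longrightarrow>
        (1 - \<delta>) * (norm K)\<^sup>2 \<le> hessian f M K K \<and>
        hessian f M K K \<le> (1 + \<delta>) * (norm K)\<^sup>2)"

definition factored :: "(real^'n^'n \<Rightarrow> real) \<Rightarrow> real^'r^'n \<Rightarrow> real" where
  "factored f U = f (U ** Finite_Cartesian_Product.transpose U)"

subsection \<open>The system of conditions\<close>

definition mat_trace :: "real mat \<Rightarrow> real" where
  "mat_trace X = (\<Sum>i<dim_row X. X $$ (i, i))"

definition mat_inner :: "real mat \<Rightarrow> real mat \<Rightarrow> real" where
  "mat_inner X Y = mat_trace (X\<^sup>T * Y)"

definition frobenius_norm :: "real mat \<Rightarrow> real" where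
  "frobenius_norm X = sqrt (\<Sum>i<dim_row X. \<Sum>j<dim_col X. (X $$ (i, j))\<^sup>2)"

definition mat_positive_definite :: "real mat \<Rightarrow> bool" where
  "mat_positive_definite X \<longleftrightarrow>
     X \<in> carrier_mat (dim_row X) (dim_row X) \<and> X\<^sup>T = X \<and>
     (\<forall>x \<in> carrier_vec (dim_row X). x \<noteq> 0\<^sub>v (dim_row X) \<longrightarrow> 0 < scalar_prod x (X *\<^sub>v x))"

text \<open>Matrix indices start at 0. The guard \<open>r < l\<close> makes the condition on the maximum
  over an empty index set vacuous.\<close>

definition conditions ::
  "nat \<Rightarrow> nat \<Rightarrow> real \<Rightarrow> real \<Rightarrow> real mat \<Rightarrow> real mat \<Rightarrow> real mat \<Rightarrow> real mat \<Rightarrow> bool" where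
  "conditions r l \<delta> \<alpha> S L A C \<longleftrightarrow>
     1 - \<delta> < \<alpha> \<and> \<alpha> \<le> (1 + \<delta>) / 2 \<and>
     S \<in> carrier_mat r r \<and> diagonal_mat S \<and>
     L \<in> carrier_mat (l - r) (l - r) \<and> diagonal_mat L \<and>
     A \<in> carrier_mat r r \<and> C \<in> carrier_mat (l - r) r \<and>
     (r < l \<longrightarrow> (1 + \<delta>) * Min ((\<lambda>i. S $$ (i, i)) ` {..<r}) \<ge> Max ((\<lambda>i. L $$ (i, i)) ` {..<l - r})) \<and>
     mat_positive_definite S \<and>
     mat_inner L (C * C\<^sup>T) =
       \<alpha> * (mat_trace (S * S) - 2 * mat_inner S (A * A\<^sup>T) + (frobenius_norm (A * A\<^sup>T))\<^sup>2
            + 2 * (frobenius_norm (A * C\<^sup>T))\<^sup>2 + (frobenius_norm (C * C\<^sup>T))\<^sup>2) \<and>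
     mat_trace (L * L) \<le> inverse \<alpha> * (2 * \<alpha> - 1 + \<delta>\<^sup>2) * mat_inner L (C * C\<^sup>T) \<and>
     mat_inner L (C * C\<^sup>T) \<noteq> 0"

end

(* Let U be a spurious second-order critical point, M = U U^T, K = M - M* and let G be
   the gradient at M. A rank-deficient U would make G positive semidefinite, hence M = M*. Otherwise
   choose an orthonormal frame of dimension l whose span contains the columns of M and M*, which
   diagonalizes M on its range and -G on the complement; Sigma and Lambda are the diagonals, and
   A, C are the coordinates of a factor of M*. On the matrices supported in this frame f is
   (1 - delta)-strongly convex with (1 + delta)-Lipschitz gradient, so cocoercivity gives the trace
   inequality with alpha = <G,K> / |K|^2. The bound alpha <= (1 + delta) / 2 comes from
   |K|^2 >= 2 min(Sigma) |C|^2, which is clear once A is rotated to be symmetric.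

   Conversely, the trace inequality says |G - K| <= delta |K|, so the quadratic form
   (1 + delta) |X|^2 - <w,X>^2 / <w,K> with w = (1 + delta) K - G has its spectrum in
   [1 - delta, 1 + delta] and sends K to G. As A C^T = 0, w is block diagonal, and the form equals
   (1 + delta) |X|^2 on off-diagonal X, which is what the second-order condition needs. *)
theory Submission
  imports Defs
begin

text \<open>The restricted isometry property controls the Hessian only along matrices of rank at
  most 2r, which are not closed under addition, so inequalities for strongly convex functions do not
  apply as they stand. Frames remedy this: the products of pairs of l frame vectors span a linear
  space whose members all have rank at most l <= 2r. Only the compression of the gradient to this
  space enters the system. In block form let Z be A stacked on C. Then K is Sigma (padded by zeros)
  minus Z Z^T, the bracket in the equation of the system is |K|^2, and <Lambda, C C^T> is <G,K>. The
  order condition is the second-order condition along variations that shift weight from an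
  eigenvector of M to a new frame direction. It gives <G,K> <= (1 + \<delta>) min(Sigma) |C|^2, the
  source of the numerator in the upper bound on \<alpha>. If A C^T is nonzero, w has an off-diagonal
  block, and the subtracted square lowers the form on some off-diagonal matrices below 1 + \<delta>,
  where the order condition may leave no slack. This separates the two directions.\<close>

subsection \<open>Second-order expansions and cocoercivity\<close>

text \<open>The Riesz representative of the Frechet derivative is assembled from its values on
  \<open>Basis\<close>, so the description operator in \<open>grad\<close> picks out an actual
  gradient.\<close>

lemma differentiable_GDERIV_grad:
  fixes f :: "'a::euclidean_space \<Rightarrow> real"
  assumes "f differentiable (at x)"
  shows "GDERIV f x :> grad f x"
proof -
  define F where "F = frechet_derivative f (at x)"
  have F: "(f has_derivative F) (at x)"
    using assms frechet_derivative_works unfolding F_def by blast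
  then have "linear F" by (rule has_derivative_linear)
  then have "F = (\<lambda>h. inner h (\<Sum>b\<in>Basis. F b *\<^sub>R b))"
  proof (intro ext)
    fix h
    have "F h = F (\<Sum>b\<in>Basis. inner h b *\<^sub>R b)" by (simp add: euclidean_representation)
    also have "\<dots> = (\<Sum>b\<in>Basis. inner h b * F b)"
      using \<open>linear F\<close> by (simp add: linear_sum linear_cmul)
    finally show "F h = inner h (\<Sum>b\<in>Basis. F b *\<^sub>R b)"
      by (simp add: inner_sum_right mult.commute)
  qed
  with F have "GDERIV f x :> (\<Sum>b\<in>Basis. F b *\<^sub>R b)"
    unfolding gderiv_def by simp
  with grad_eqI[OF this] show ?thesis by simp
qed

lemma GDERIV_line:
  assumes "GDERIV f (x + t *\<^sub>R u) :> D"
  shows "((\<lambda>s. f (x + s *\<^sub>R u)) has_real_derivative inner D u) (at t)"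
proof -
  have "((\<lambda>s. x + s *\<^sub>R u) has_derivative (\<lambda>s. s *\<^sub>R u)) (at t)"
    by (auto intro!: derivative_eq_intros)
  from has_derivative_compose[OF this] assms
  have "((\<lambda>s. f (x + s *\<^sub>R u)) has_derivative (\<lambda>s. inner (s *\<^sub>R u) D)) (at t)"
    unfolding gderiv_def by blast
  then show ?thesis
    unfolding has_field_derivative_def by (simp add: inner_commute mult_commute_abs)
qed

text \<open>Taylor's theorem of order two along a line. The position of t is left open: in the
  applications the whole line stays in the region where the Hessian is controlled.\<close>

lemma taylor_hessian:
  fixes f :: "'a::euclidean_space \<Rightarrow> real"
  assumes f: "twice_continuously_differentiable f"
  obtains t where "f (x + u) = f x + inner (grad f x) u + hessian f (x + t *\<^sub>R u) u u / 2"
proof -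
  define d where "d m t = (if m = 0 then f (x + t *\<^sub>R u)
     else if m = 1 then inner (grad f (x + t *\<^sub>R u)) u
     else hessian f (x + t *\<^sub>R u) u u)" for m :: nat and t
  have 0: "(d 0 has_real_derivative d 1 t) (at t)" for t
    using GDERIV_line[OF differentiable_GDERIV_grad] f
    unfolding d_def twice_continuously_differentiable_def by fastforce
  have 1: "(d 1 has_real_derivative d 2 t) (at t)" for t
  proof -
    let ?F = "frechet_derivative (grad f) (at (x + t *\<^sub>R u))"
    have F: "(grad f has_derivative ?F) (at (x + t *\<^sub>R u))"
      using f frechet_derivative_works unfolding twice_continuously_differentiable_def by blast
    have "((\<lambda>s. x + s *\<^sub>R u) has_derivative (\<lambda>s. s *\<^sub>R u)) (at t)"
      by (auto intro!: derivative_eq_intros)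
    from has_derivative_compose[OF this F]
    have "((\<lambda>s. grad f (x + s *\<^sub>R u)) has_derivative (\<lambda>s. ?F (s *\<^sub>R u))) (at t)" .
    then have "((\<lambda>s. inner (grad f (x + s *\<^sub>R u)) u) has_derivative (\<lambda>s. inner (?F (s *\<^sub>R u)) u)) (at t)"
      by (rule has_derivative_inner_left)
    moreover have "inner (?F (s *\<^sub>R u)) u = hessian f (x + t *\<^sub>R u) u u * s" for s
      using has_derivative_linear[OF F] by (simp add: linear_cmul hessian_def)
    moreover have "d 1 = (\<lambda>s. inner (grad f (x + s *\<^sub>R u)) u)" "d 2 t = hessian f (x + t *\<^sub>R u) u u"
      by (auto simp: d_def)
    ultimately show ?thesis by (simp add: has_field_derivative_def)
  qed
  have "\<forall>m t. m < 2 \<and> 0 \<le> t \<and> t \<le> 1 \<longrightarrow> DERIV (d m) t :> d (Suc m) t"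
    using 0 1 by (auto simp: less_Suc_eq numeral_2_eq_2)
  from Taylor_up[of 2 d "d 0" 0 1 0, OF _ _ this]
  obtain t where "d 0 1 = (\<Sum>m<2. d m 0 / fact m * (1 - 0) ^ m) + d 2 t / fact 2 * (1 - 0)\<^sup>2"
    by auto
  then have "f (x + u) = f x + inner (grad f x) u + hessian f (x + t *\<^sub>R u) u u / 2"
    by (simp add: d_def numeral_2_eq_2)
  then show thesis by (rule that)
qed

text \<open>Working with function values makes the symmetry of the Hessian dispensable.\<close>

lemma cocoercive_on_subspace:
  fixes f :: "'a::euclidean_space \<Rightarrow> real"
  assumes f: "twice_continuously_differentiable f"
    and S: "subspace S" "x \<in> S" "y \<in> S" "D \<in> S"
    and D: "\<And>z. z \<in> S \<Longrightarrow> inner D z = inner (grad f y - grad f x) z"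
    and hess: "\<And>z u. z \<in> S \<Longrightarrow> u \<in> S \<Longrightarrow>
      (1 - \<delta>) * (norm u)\<^sup>2 \<le> hessian f z u u \<and> hessian f z u u \<le> (1 + \<delta>) * (norm u)\<^sup>2"
    and \<delta>: "0 \<le> \<delta>"
  shows "(1 - \<delta>\<^sup>2) * (norm (y - x))\<^sup>2 + (norm D)\<^sup>2 \<le> 2 * inner D (y - x)"
proof -
  have lower: "f a + inner (grad f a) u + (1 - \<delta>) / 2 * (norm u)\<^sup>2 \<le> f (a + u)"
    and upper: "f (a + u) \<le> f a + inner (grad f a) u + (1 + \<delta>) / 2 * (norm u)\<^sup>2"
    if "a \<in> S" "u \<in> S" for a u
  proof -
    obtain t where t: "f (a + u) = f a + inner (grad f a) u + hessian f (a + t *\<^sub>R u) u u / 2"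
      using taylor_hessian[OF f] by blast
    have "a + t *\<^sub>R u \<in> S" using S that by (simp add: subspace_add subspace_scale)
    from hess[OF this \<open>u \<in> S\<close>] t
    show "f a + inner (grad f a) u + (1 - \<delta>) / 2 * (norm u)\<^sup>2 \<le> f (a + u)"
      "f (a + u) \<le> f a + inner (grad f a) u + (1 + \<delta>) / 2 * (norm u)\<^sup>2" by auto
  qed
  \<comment> \<open>On S, \<open>E\<close> represents the gradient difference of f - (1 -
    \<delta>)/2 |.|^2, a function that is convex there with curvature at most 2 \<delta>.\<close>
  define E where "E = D - (1 - \<delta>) *\<^sub>R (y - x)"
  have "E \<in> S" using S by (simp add: E_def subspace_diff subspace_scale)
  \<comment> \<open>The point z is a gradient step of length s from a. The lower expansion at b and
    the upper expansion at a bracket f z, and their quadratic terms differ by \<delta> s^2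
    |e|^2.\<close>
  have key: "(s - \<delta> * s\<^sup>2) * (norm E)\<^sup>2 \<le>
      f a - f b - inner (grad f b) (a - b) - (1 - \<delta>) / 2 * (norm (a - b))\<^sup>2"
    if ab: "a \<in> S" "b \<in> S"
      and E: "\<And>z. z \<in> S \<Longrightarrow> inner e z = inner (grad f a - grad f b - (1 - \<delta>) *\<^sub>R (a - b)) z"
      and e: "e \<in> S" "norm e = norm E" for a b s e
  proof -
    define z where "z = a - s *\<^sub>R e"
    have se: "- (s *\<^sub>R e) \<in> S" using e S by (simp add: subspace_scale subspace_neg)
    have "f b + inner (grad f b) (z - b) + (1 - \<delta>) / 2 * (norm (z - b))\<^sup>2 \<le> f z"
      using lower[of b "z - b"] ab e S by (simp add: z_def subspace_diff subspace_scale)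
    moreover have "f z \<le> f a + inner (grad f a) (z - a) + (1 + \<delta>) / 2 * (norm (z - a))\<^sup>2"
      using upper[of a "z - a"] ab se by (simp add: z_def)
    moreover have "inner (grad f a) e = inner (grad f b) e + (1 - \<delta>) * inner (a - b) e + (norm e)\<^sup>2"
      using E[OF e(1)] by (simp add: inner_diff_left power2_norm_eq_inner)
    moreover have "(norm (z - b))\<^sup>2 = (norm (a - b))\<^sup>2 - 2 * s * inner (a - b) e + s\<^sup>2 * (norm e)\<^sup>2"
      unfolding z_def power2_norm_eq_inner
      by (simp add: inner_diff_left inner_diff_right inner_commute algebra_simps power2_eq_square)
    moreover have "(norm (z - a))\<^sup>2 = s\<^sup>2 * (norm e)\<^sup>2"
      by (simp add: z_def power_mult_distrib)
    moreover have "inner (grad f b) (z - b) = inner (grad f b) (a - b) - s * inner (grad f b) e"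
      "inner (grad f a) (z - a) = - s * inner (grad f a) e"
      by (simp_all add: z_def inner_diff_right)
    ultimately show ?thesis
      unfolding e(2)[symmetric] by (simp add: field_simps)
  qed
  have 1: "(s - \<delta> * s\<^sup>2) * (norm E)\<^sup>2 \<le>
      f y - f x - inner (grad f x) (y - x) - (1 - \<delta>) / 2 * (norm (y - x))\<^sup>2" for s
    by (rule key[of _ _ E]) (use S \<open>E \<in> S\<close> D in \<open>auto simp: E_def inner_diff_left\<close>)
  have 2: "(s - \<delta> * s\<^sup>2) * (norm E)\<^sup>2 \<le>
      f x - f y - inner (grad f y) (x - y) - (1 - \<delta>) / 2 * (norm (x - y))\<^sup>2" for s
  proof (rule key[of _ _ "- E"])
    show "inner (- E) z = inner (grad f x - grad f y - (1 - \<delta>) *\<^sub>R (x - y)) z" if "z \<in> S" for z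
      using D[OF that] by (simp add: E_def inner_diff_left inner_add_left algebra_simps)
  qed (use S \<open>E \<in> S\<close> in \<open>auto simp: subspace_neg\<close>)
  have DE: "inner D (y - x) - (1 - \<delta>) * (norm (y - x))\<^sup>2 = inner E (y - x)"
    by (simp add: E_def inner_diff_left power2_norm_eq_inner)
  \<comment> \<open>Adding the estimates for (x, y) and (y, x) cancels the function values.\<close>
  have sum: "2 * (s - \<delta> * s\<^sup>2) * (norm E)\<^sup>2 \<le> inner E (y - x)" for s
  proof -
    have "inner D (y - x) = inner (grad f y - grad f x) (y - x)"
      using D S by (simp add: subspace_diff)
    then show ?thesis using 1[of s] 2[of s] unfolding DE[symmetric] norm_minus_commute[of x y]
      by (simp add: inner_diff_left inner_diff_right field_simps)
  qed
  \<comment> \<open>The factor s - \<delta> s^2 is largest at s = 1/(2 \<delta>), with value 1/(4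
    \<delta>). For \<delta> = 0 it is unbounded, which forces \<open>E = 0\<close>.\<close>
  have "(norm E)\<^sup>2 \<le> 2 * \<delta> * inner E (y - x)"
  proof (cases "\<delta> = 0")
    case True
    have "E = 0"
    proof (rule ccontr)
      assume "E \<noteq> 0"
      then have "inner E (y - x) < 2 * (inner E (y - x) / (norm E)\<^sup>2 / 2 + 1) * (norm E)\<^sup>2"
        by (simp add: field_simps)
      with sum[of "inner E (y - x) / (norm E)\<^sup>2 / 2 + 1"] True show False by simp
    qed
    then show ?thesis by simp
  next
    case False
    with \<delta> sum[of "1 / (2 * \<delta>)"] show ?thesis
      by (simp add: field_simps power2_eq_square)
  qed
  moreover have "(norm E)\<^sup>2 = (norm D)\<^sup>2 - 2 * (1 - \<delta>) * inner D (y - x) + (1 - \<delta>)\<^sup>2 * (norm (y - x))\<^sup>2"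
    unfolding E_def power2_norm_eq_inner
    by (simp add: inner_diff_left inner_diff_right inner_commute algebra_simps power2_eq_square)
  ultimately show ?thesis
    unfolding DE[symmetric] by (simp add: algebra_simps power2_eq_square)
qed

subsection \<open>Outer products\<close>

abbreviation transp :: "'a^'n^'m \<Rightarrow> 'a^'m^'n" where
  "transp \<equiv> Finite_Cartesian_Product.transpose"

definition outer :: "real^'m \<Rightarrow> real^'n \<Rightarrow> real^'n^'m" where
  "outer x y = (\<chi> i j. x $ i * y $ j)"

lemma inner_outer: "inner (outer x y) (outer u v) = inner x u * inner y v"
  by (simp add: outer_def inner_vec_def sum_product ac_simps) (rule sum.swap)

lemma outer_mult_vec: "outer x y *v z = inner y z *\<^sub>R x"
  by (simp add: outer_def Finite_Cartesian_Product.vec_eq_iff matrix_vector_mult_def inner_vec_def sum_distrib_left ac_simps)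

lemma transp_outer: "transp (outer x y) = outer y x"
  by (simp add: outer_def Finite_Cartesian_Product.vec_eq_iff Finite_Cartesian_Product.transpose_def ac_simps)

lemma bilinear_outer: "bilinear outer"
  unfolding bilinear_def
  by (auto intro!: linearI simp: outer_def Finite_Cartesian_Product.vec_eq_iff algebra_simps)

lemmas outer_simps =
  bilinear_ladd[OF bilinear_outer] bilinear_radd[OF bilinear_outer]
  bilinear_lsub[OF bilinear_outer] bilinear_rsub[OF bilinear_outer]
  bilinear_lmul[OF bilinear_outer] bilinear_rmul[OF bilinear_outer]
  bilinear_lzero[OF bilinear_outer] bilinear_rzero[OF bilinear_outer]

lemma inner_matrix_outer: "inner G (outer x y) = inner x (G *v y)"
  by (simp add: outer_def inner_vec_def matrix_vector_mult_def sum_distrib_left ac_simps)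

lemma sum_outer_mult_vec: "(\<Sum>i\<in>I. c i *\<^sub>R outer (x i) (y i)) *v v = (\<Sum>i\<in>I. (c i * inner (y i) v) *\<^sub>R x i)"
proof -
  have "linear (\<lambda>A. A *v v)"
    by (auto intro!: linearI simp: matrix_vector_mult_add_rdistrib scaleR_matrix_vector_assoc)
  from linear_sum[OF this, of "\<lambda>i. c i *\<^sub>R outer (x i) (y i)" I] show ?thesis
    by (simp add: scaleR_matrix_vector_assoc[symmetric] outer_mult_vec)
qed

lemma minus_mult_vec: "(- A) *v x = - ((A :: real^'n^'m) *v x)"
  using matrix_vector_mult_diff_rdistrib[of 0 A x] by simp

lemma sum_outer_mult_vec': "(\<Sum>i\<in>I. outer (x i) (y i)) *v v = (\<Sum>i\<in>I. inner (y i) v *\<^sub>R x i)"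
  using sum_outer_mult_vec[of "\<lambda>_. 1" x y I v] by simp

lemma matrix_mult_outer: "A ** outer x y = outer (A *v x) (y :: real^'k)"
  for A :: "real^'n^'m"
  by (simp add: matrix_eq matrix_vector_mul_assoc[symmetric] outer_mult_vec matrix_vector_mult_scaleR)

lemma transp_add: "transp (A + B) = transp A + transp (B :: real^'n^'m)"
  and transp_diff: "transp (A - B) = transp A - transp B"
  and transp_minus: "transp (- A) = - transp A"
  and transp_scaleR: "transp (c *\<^sub>R A) = c *\<^sub>R transp A"
  by (simp_all add: Finite_Cartesian_Product.vec_eq_iff Finite_Cartesian_Product.transpose_def)

lemma linear_transp: "linear (transp :: real^'n^'m \<Rightarrow> real^'m^'n)"
  by (intro linearI transp_add transp_scaleR)

lemma transp_sum: "transp (sum f I) = (\<Sum>i\<in>I. transp (f i :: real^'n^'m))"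
  using linear_sum[OF linear_transp] by blast

lemma inner_transp: "inner (transp A) (transp B) = inner A (B :: real^'n^'m)"
  unfolding inner_vec_def Finite_Cartesian_Product.transpose_def by simp (rule sum.swap)

lemma inner_matrix_mult_right:
  fixes A :: "real^'n^'m" and B :: "real^'k^'n" and C :: "real^'k^'m"
  shows "inner (A ** B) C = inner B (transp A ** C)"
  unfolding inner_eq_trace
  by (simp add: Finite_Cartesian_Product.matrix_transpose_mul matrix_mul_assoc)

lemma inner_matrix_mult_left:
  fixes A :: "real^'n^'m" and B :: "real^'k^'n" and C :: "real^'k^'m"
  shows "inner (A ** B) C = inner A (C ** transp B)"
proof -
  have "inner (A ** B) C = inner (transp B ** transp A) (transp C)"
    unfolding Finite_Cartesian_Product.matrix_transpose_mul[symmetric] by (rule inner_transp[symmetric])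
  also have "\<dots> = inner (transp A) (transp (C ** transp B))"
    unfolding inner_matrix_mult_right Finite_Cartesian_Product.matrix_transpose_mul
      Finite_Cartesian_Product.transpose_transpose ..
  also have "\<dots> = inner A (C ** transp B)" by (rule inner_transp)
  finally show ?thesis .
qed

lemma bounded_bilinear_matrix_mult:
  "bounded_bilinear (\<lambda>A B. (A :: real^'n^'m) ** (B :: real^'k^'n))"
proof -
  have "linear (\<lambda>B. (A :: real^'n^'m) ** (B :: real^'k^'n))" for A
    by (rule linearI) (simp_all add: matrix_matrix_mult_def Finite_Cartesian_Product.vec_eq_iff
        sum.distrib distrib_left sum_distrib_left mult.left_commute)
  moreover have "linear (\<lambda>A. (A :: real^'n^'m) ** (B :: real^'k^'n))" for B
    by (rule linearI) (simp_all add: matrix_matrix_mult_def Finite_Cartesian_Product.vec_eq_iff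
        sum.distrib distrib_right sum_distrib_left mult.assoc)
  ultimately show ?thesis
    by (simp add: bilinear_conv_bounded_bilinear[symmetric] bilinear_def)
qed

subsection \<open>Gradient and Hessian of the factored objective\<close>

lemma symmetric_matrix_gram: "symmetric_matrix (U ** transp U)"
  by (simp add: symmetric_matrix_def Finite_Cartesian_Product.matrix_transpose_mul)

lemma inner_symmetric_transp:
  assumes "symmetric_matrix S"
  shows "inner S (transp X) = inner S X"
  using assms inner_transp[of S X] by (simp add: symmetric_matrix_def)

text \<open>The product rule yields \<open>U ** transp V\<close> and its transpose. A symmetric
  gradient pairs equally with both, whence the factor 2.\<close>

lemma GDERIV_factored:
  fixes f :: "real^'n^'n \<Rightarrow> real" and U :: "real^'r^'n"
  assumes f: "f differentiable (at (U ** transp U))"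
    and sym: "symmetric_matrix (grad f (U ** transp U))"
  shows "GDERIV (factored f) U :> 2 *\<^sub>R (grad f (U ** transp U) ** U)"
proof -
  let ?G = "grad f (U ** transp U)"
  have "(transp has_derivative transp) (at U)"
    by (rule linear_imp_has_derivative[OF linear_transp])
  then have "((\<lambda>V. V ** transp V) has_derivative (\<lambda>V. U ** transp V + V ** transp U)) (at U)"
    by (intro bounded_bilinear.FDERIV[OF bounded_bilinear_matrix_mult] has_derivative_ident)
  from has_derivative_compose[OF this, of f] differentiable_GDERIV_grad[OF f]
  have "(factored f has_derivative (\<lambda>V. inner (U ** transp V + V ** transp U) ?G)) (at U)"
    by (simp add: gderiv_def factored_def[abs_def])
  moreover have "inner (U ** transp V + V ** transp U) ?G = inner V (2 *\<^sub>R (?G ** U))" for V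
  proof -
    have "inner (U ** transp V) ?G = inner (V ** transp U) ?G"
      using inner_symmetric_transp[OF sym, of "V ** transp U"]
      by (simp add: Finite_Cartesian_Product.matrix_transpose_mul inner_commute)
    then show ?thesis
      by (simp add: inner_add_left inner_matrix_mult_left Finite_Cartesian_Product.transpose_transpose)
  qed
  ultimately show ?thesis by (simp add: gderiv_def)
qed

lemma
  fixes f :: "real^'n^'n \<Rightarrow> real" and U :: "real^'r^'n"
  assumes f: "twice_continuously_differentiable f"
    and sym: "\<And>M. symmetric_matrix M \<Longrightarrow> symmetric_matrix (grad f M)"
  shows grad_factored: "grad (factored f) U = 2 *\<^sub>R (grad f (U ** transp U) ** U)"
    and hessian_factored: "hessian (factored f) U V V =
      2 * inner (grad f (U ** transp U)) (V ** transp V) +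
      hessian f (U ** transp U) (U ** transp V + V ** transp U) (U ** transp V + V ** transp U)"
proof -
  have grad: "grad (factored f) W = 2 *\<^sub>R (grad f (W ** transp W) ** W)" for W :: "real^'r^'n"
    using f sym[OF symmetric_matrix_gram]
    by (intro grad_eqI GDERIV_factored) (auto simp: twice_continuously_differentiable_def)
  then show "grad (factored f) U = 2 *\<^sub>R (grad f (U ** transp U) ** U)" .
  define M where "M = U ** transp U"
  define D where "D = frechet_derivative (grad f) (at M)"
  define X where "X V = U ** transp V + V ** transp U" for V
  have D: "(grad f has_derivative D) (at (U ** transp U))"
    using f unfolding twice_continuously_differentiable_def D_def M_def frechet_derivative_works by blast
  have "(transp has_derivative transp) (at U)"
    by (rule linear_imp_has_derivative[OF linear_transp])
  then have "((\<lambda>W. W ** transp W) has_derivative X) (at U)"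
    unfolding X_def
    by (intro bounded_bilinear.FDERIV[OF bounded_bilinear_matrix_mult] has_derivative_ident)
  from has_derivative_compose[OF this D]
  have G: "((\<lambda>W. grad f (W ** transp W)) has_derivative (\<lambda>V. D (X V))) (at U)" .
  \<comment> \<open>The gradient is symmetric along the whole image of W |-> W W^T, so its
    derivative in the tangent directions \<open>X V\<close> is symmetric as well. This stands in for
    the symmetry of second derivatives.\<close>
  have "((\<lambda>W. transp (grad f (W ** transp W))) has_derivative (\<lambda>V. transp (D (X V)))) (at U)"
    using linear_imp_has_derivative[OF linear_transp] by (rule has_derivative_compose[OF G])
  moreover have "(\<lambda>W. transp (grad f (W ** transp W))) = (\<lambda>W::real^'r^'n. grad f (W ** transp W))"
    by (rule ext) (use sym[OF symmetric_matrix_gram] in \<open>simp add: symmetric_matrix_def\<close>)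
  ultimately have "(\<lambda>V. transp (D (X V))) = (\<lambda>V. D (X V))"
    using has_derivative_unique[OF _ G] by simp
  then have DX: "symmetric_matrix (D (X V))"
    unfolding symmetric_matrix_def by (rule fun_cong)
  have "((\<lambda>W. 2 *\<^sub>R (grad f (W ** transp W) ** W)) has_derivative
      (\<lambda>V. 2 *\<^sub>R (grad f (U ** transp U) ** V + D (X V) ** U))) (at U)"
    by (intro has_derivative_scaleR_right bounded_bilinear.FDERIV[OF bounded_bilinear_matrix_mult]
        has_derivative_ident G)
  then have "frechet_derivative (grad (factored f)) (at U) V = 2 *\<^sub>R (grad f M ** V + D (X V) ** U)"
    unfolding M_def grad[abs_def] by (simp add: frechet_derivative_at[symmetric])
  then have "hessian (factored f) U V V = 2 * inner (grad f M ** V) V + 2 * inner (D (X V) ** U) V"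
    by (simp add: hessian_def inner_add_left)
  also have "inner (grad f M ** V) V = inner (grad f M) (V ** transp V)"
    by (simp add: inner_matrix_mult_left)
  also have "2 * inner (D (X V) ** U) V = inner (D (X V)) (X V)"
    using inner_symmetric_transp[OF DX, of "V ** transp U"]
    by (simp add: inner_matrix_mult_left X_def inner_add_right Finite_Cartesian_Product.matrix_transpose_mul)
  finally show "hessian (factored f) U V V = 2 * inner (grad f (U ** transp U)) (V ** transp V) +
      hessian f (U ** transp U) (U ** transp V + V ** transp U) (U ** transp V + V ** transp U)"
    by (simp add: hessian_def D_def X_def M_def)
qed

subsection \<open>Diagonalizing a self-adjoint map on a subspace\<close>

definition orthonormal_on :: "'i set \<Rightarrow> ('i \<Rightarrow> 'a::real_inner) \<Rightarrow> bool" where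
  "orthonormal_on I q \<longleftrightarrow> (\<forall>i\<in>I. \<forall>j\<in>I. inner (q i) (q j) = (if i = j then 1 else 0))"

lemma orthonormal_onD:
  "orthonormal_on I q \<Longrightarrow> i \<in> I \<Longrightarrow> j \<in> I \<Longrightarrow> inner (q i) (q j) = (if i = j then 1 else 0)"
  by (simp add: orthonormal_on_def)

lemma orthonormal_on_subset: "orthonormal_on I q \<Longrightarrow> J \<subseteq> I \<Longrightarrow> orthonormal_on J q"
  unfolding orthonormal_on_def by (meson subsetD)

text \<open>At a maximizer \<open>b\<close> of the quadratic form on the unit sphere, the first variation
  in a tangent direction \<open>y\<close> is \<open>2 \<langle>T b, y\<rangle>\<close>.\<close>

lemma quadratic_form_maximizer:
  fixes T :: "'a::euclidean_space \<Rightarrow> 'a"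
  assumes T: "linear T" "\<And>x y. inner (T x) y = inner x (T y)"
    and S: "subspace S" "S \<noteq> {0}"
  obtains b where "b \<in> S" "norm b = 1"
    "\<And>y. y \<in> S \<Longrightarrow> inner b y = 0 \<Longrightarrow> inner (T b) y = 0"
proof -
  let ?K = "S \<inter> sphere 0 1"
  obtain x where x: "x \<in> S" "x \<noteq> 0" using S subspace_0 by blast
  then have "x /\<^sub>R norm x \<in> ?K" using S by (simp add: subspace_scale)
  then have "?K \<noteq> {}" by blast
  moreover have "compact ?K"
    by (intro closed_Int_compact closed_subspace S compact_sphere)
  moreover have "continuous_on ?K (\<lambda>x. inner (T x) x)"
    using T(1) by (intro continuous_intros linear_continuous_on) (simp add: linear_conv_bounded_linear)
  ultimately obtain b where b: "b \<in> ?K" "\<And>x. x \<in> ?K \<Longrightarrow> inner (T x) x \<le> inner (T b) b"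
    using continuous_attains_sup[of ?K "\<lambda>x. inner (T x) x"] by blast
  have max: "inner (T x) x \<le> inner (T b) b * (norm x)\<^sup>2" if "x \<in> S" for x
  proof (cases "x = 0")
    case False
    have "inner (T (x /\<^sub>R norm x)) (x /\<^sub>R norm x) \<le> inner (T b) b"
      using that S False by (intro b) (simp add: subspace_scale)
    then show ?thesis using False T(1)
      by (simp add: linear_cmul field_simps power2_eq_square)
  qed (simp add: T(1) linear_0)
  have "inner (T b) y = 0" if y: "y \<in> S" "inner b y = 0" for y
  proof (rule ccontr)
    define c where "c = inner (T b) y"
    define m where "m = inner (T b) b * (norm y)\<^sup>2 - inner (T y) y"
    assume "inner (T b) y \<noteq> 0"
    then have "c \<noteq> 0" by (simp add: c_def)
    have *: "2 * t * c \<le> t\<^sup>2 * m" for t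
    proof -
      have "b + t *\<^sub>R y \<in> S" using b y S by (simp add: subspace_add subspace_scale)
      from max[OF this] have "inner (T b) b + 2 * t * c + t\<^sup>2 * inner (T y) y
          \<le> inner (T b) b * (norm (b + t *\<^sub>R y))\<^sup>2"
        using T by (simp add: linear_add linear_cmul inner_add_left inner_add_right c_def
            inner_commute power2_eq_square algebra_simps)
      moreover have "(norm (b + t *\<^sub>R y))\<^sup>2 = 1 + t\<^sup>2 * (norm y)\<^sup>2"
        unfolding power2_norm_eq_inner using b y
        by (simp add: inner_add_left inner_add_right inner_commute power2_eq_square norm_eq_1)
      ultimately show ?thesis by (simp add: m_def algebra_simps)
    qed
    \<comment> \<open>The substitution t = s c removes the sign of c. For small positive s the
      linear side then exceeds the quadratic one, and s = 1/(|m| + 1) is small enough.\<close>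
    have "c\<^sup>2 * (2 * s) \<le> c\<^sup>2 * (s\<^sup>2 * m)" for s
      using *[of "s * c"] by (simp add: power2_eq_square ac_simps)
    then have **: "2 * s \<le> s\<^sup>2 * m" for s
      using \<open>c \<noteq> 0\<close> by (subst (asm) mult_le_cancel_left_pos) auto
    have "2 * (1 / (\<bar>m\<bar> + 1)) \<le> (1 / (\<bar>m\<bar> + 1)) * (m / (\<bar>m\<bar> + 1))"
      using **[of "1 / (\<bar>m\<bar> + 1)"] by (simp add: power2_eq_square)
    also have "\<dots> \<le> (1 / (\<bar>m\<bar> + 1)) * 1"
      by (intro mult_left_mono) (auto simp: divide_le_eq_1)
    finally show False by (auto simp: divide_le_cancel)
  qed
  with b that show thesis by auto
qed

lemma subspace_split_vector:
  fixes b :: "'a::euclidean_space"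
  assumes S: "subspace S" and b: "b \<in> S" "norm b = 1"
  shows "subspace {x \<in> S. inner b x = 0}" "dim S = Suc (dim {x \<in> S. inner b x = 0})"
proof -
  let ?S = "{x \<in> S. inner b x = 0}"
  show "subspace ?S" using S by (auto simp: subspace_def inner_add_right)
  have "S = span (insert b ?S)"
  proof
    show "span (insert b ?S) \<subseteq> S" using S b by (intro span_minimal) auto
    show "S \<subseteq> span (insert b ?S)"
    proof
      fix x assume "x \<in> S"
      have "x - inner b x *\<^sub>R b \<in> ?S"
        using \<open>x \<in> S\<close> b S by (simp add: subspace_diff subspace_scale inner_diff_right norm_eq_1)
      then have "(x - inner b x *\<^sub>R b) + inner b x *\<^sub>R b \<in> span (insert b ?S)"
        by (intro span_add span_scale span_base) auto
      then show "x \<in> span (insert b ?S)" by simp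
    qed
  qed
  then have "dim S = dim (insert b ?S)" using dim_span[of "insert b ?S"] by simp
  moreover have "b \<notin> span ?S"
    unfolding span_eq_iff[THEN iffD2, OF \<open>subspace ?S\<close>] using b by (simp add: norm_eq_1)
  ultimately show "dim S = Suc (dim ?S)" by (simp add: dim_insert)
qed

text \<open>What is diagonalized is the compression of T to S; if S is not invariant under T, the
  vectors need not be eigenvectors. The gradient at M calls for this generality. The induction
  splits off a maximizer of the quadratic form and continues in its orthogonal complement within
  S.\<close>

lemma diagonalize_on_subspace:
  fixes T :: "'a::euclidean_space \<Rightarrow> 'a"
  assumes T: "linear T" "\<And>x y. inner (T x) y = inner x (T y)"
    and S: "subspace S"
  obtains b where "orthonormal_on {..<dim S} b" "span (b ` {..<dim S}) = S"
    "\<And>i j. i < dim S \<Longrightarrow> j < dim S \<Longrightarrow> i \<noteq> j \<Longrightarrow> inner (T (b i)) (b j) = 0"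
proof -
  have "\<exists>b. orthonormal_on {..<d} b \<and> span (b ` {..<d}) = S \<and>
      (\<forall>i<d. \<forall>j<d. i \<noteq> j \<longrightarrow> inner (T (b i)) (b j) = 0)" if "d = dim S" for d
    using that S
  proof (induction d arbitrary: S)
    case 0
    then have "S = {0}" using subspace_0[of S] dim_eq_0[of S] by auto
    then show ?case by (simp add: orthonormal_on_def)
  next
    case (Suc d)
    have "S \<noteq> {0}" using Suc.prems by auto
    from quadratic_form_maximizer[OF T Suc.prems(2) this]
    obtain c where c: "c \<in> S" "norm c = 1"
      "\<And>y. y \<in> S \<Longrightarrow> inner c y = 0 \<Longrightarrow> inner (T c) y = 0" by blast
    let ?S = "{x \<in> S. inner c x = 0}"
    note split = subspace_split_vector[OF Suc.prems(2) c(1,2)]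
    have "d = dim ?S" using split(2) Suc.prems(1) by simp
    from Suc.IH[OF this split(1)] obtain b where b: "orthonormal_on {..<d} b" "span (b ` {..<d}) = ?S"
      "\<And>i j. i < d \<Longrightarrow> j < d \<Longrightarrow> i \<noteq> j \<Longrightarrow> inner (T (b i)) (b j) = 0" by blast
    have bS: "b i \<in> ?S" if "i < d" for i
      unfolding b(2)[symmetric] using that by (intro span_base) simp
    define b' where "b' = b(d := c)"
    have "orthonormal_on {..<Suc d} b'"
      using orthonormal_onD[OF b(1)] bS c(2)
      by (auto simp: orthonormal_on_def b'_def less_Suc_eq norm_eq_1 inner_commute)
    moreover have "span (b' ` {..<Suc d}) = S"
    proof
      have im: "b' ` {..<Suc d} = insert c (b ` {..<d})"
        by (auto simp: b'_def less_Suc_eq image_iff)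
      show "span (b' ` {..<Suc d}) \<subseteq> S"
        unfolding im using bS c(1) Suc.prems(2) by (intro span_minimal) auto
      show "S \<subseteq> span (b' ` {..<Suc d})"
      proof
        fix x assume "x \<in> S"
        have "x - inner c x *\<^sub>R c \<in> ?S"
          using \<open>x \<in> S\<close> c(1,2) Suc.prems(2)
          by (simp add: subspace_diff subspace_scale inner_diff_right norm_eq_1)
        then have "x - inner c x *\<^sub>R c \<in> span (insert c (b ` {..<d}))"
          unfolding b(2)[symmetric] using span_mono[of "b ` {..<d}" "insert c (b ` {..<d})"] by blast
        then have "(x - inner c x *\<^sub>R c) + inner c x *\<^sub>R c \<in> span (insert c (b ` {..<d}))"
          by (intro span_add span_scale) (auto intro: span_base)
        then show "x \<in> span (b' ` {..<Suc d})" by (simp add: im)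
      qed
    qed
    moreover have "inner (T (b' i)) (b' j) = 0" if "i < Suc d" "j < Suc d" "i \<noteq> j" for i j
    proof -
      have "inner (T c) (b k) = 0" "inner (T (b k)) c = 0" if "k < d" for k
        using bS[OF that] c(3)[of "b k"] T(2)[of "b k" c] inner_commute[of "b k" "T c"] by auto
      then show ?thesis using that b(3) by (auto simp: b'_def less_Suc_eq)
    qed
    ultimately show ?case by (intro exI[of _ b']) simp
  qed
  from this[OF refl] that show thesis by blast
qed

section \<open>Coordinates in orthonormal families and the spectral theorem\<close>

lemma orthonormal_expand:
  assumes "orthonormal_on I b" "finite I" "x \<in> span (b ` I)"
  shows "x = (\<Sum>i\<in>I. inner (b i) x *\<^sub>R b i)"
proof -
  define p where "p x = (\<Sum>i\<in>I. inner (b i) x *\<^sub>R b i)" for x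
  have "linear p"
    by (rule linearI)
      (simp_all add: p_def scaleR_sum_right inner_add_right scaleR_add_left sum.distrib)
  moreover have "p (b j) = b j" if "j \<in> I" for j
  proof -
    have "p (b j) = (\<Sum>i\<in>I. if i = j then b j else 0)"
      unfolding p_def using orthonormal_onD[OF assms(1) _ that] by (intro sum.cong) auto
    then show ?thesis using assms(2) that by simp
  qed
  ultimately have "p x = id x"
    using linear_eq_on_span[OF _ linear_id _ assms(3), of p] by force
  then show ?thesis unfolding p_def by simp
qed

lemma bessel_inequality:
  assumes "orthonormal_on I b" "finite I"
  shows "(\<Sum>i\<in>I. (inner (b i) x)\<^sup>2) \<le> (norm x)\<^sup>2"
proof -
  let ?p = "\<Sum>i\<in>I. inner (b i) x *\<^sub>R b i"
  have "inner ?p ?p = (\<Sum>i\<in>I. \<Sum>j\<in>I. inner (b i) x * (inner (b j) x * inner (b j) (b i)))"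
    by (simp add: inner_sum_left inner_sum_right sum_distrib_left)
  also have "\<dots> = (\<Sum>i\<in>I. \<Sum>j\<in>I. if j = i then (inner (b i) x)\<^sup>2 else 0)"
    using orthonormal_onD[OF assms(1)] by (intro sum.cong refl) (auto simp: power2_eq_square)
  also have "\<dots> = (\<Sum>i\<in>I. (inner (b i) x)\<^sup>2)" using assms(2) by simp
  finally have pp: "inner ?p ?p = (\<Sum>i\<in>I. (inner (b i) x)\<^sup>2)" .
  have "inner ?p x = (\<Sum>i\<in>I. (inner (b i) x)\<^sup>2)"
    by (simp add: inner_sum_left power2_eq_square)
  then have "(norm (x - ?p))\<^sup>2 = (norm x)\<^sup>2 - (\<Sum>i\<in>I. (inner (b i) x)\<^sup>2)"
    unfolding power2_norm_eq_inner inner_diff_left inner_diff_right pp by (simp add: inner_commute)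
  then show ?thesis using zero_le_power2[of "norm (x - ?p)"] by linarith
qed

lemma symmetric_matrix_inner:
  assumes "symmetric_matrix M"
  shows "inner (M *v x) y = inner x (M *v y)"
  using dot_lmul_matrix[of x M y] assms[unfolded symmetric_matrix_def]
  unfolding transpose_matrix_vector[symmetric] by simp

text \<open>The range of M is invariant, so the diagonalizing vectors found there are eigenvectors
  and their number is the rank. Every \<open>M *v x\<close> lies in the range, and expanding it in
  these vectors gives the sum.\<close>

lemma spectral_decomposition:
  fixes M :: "real^'n^'n"
  assumes M: "symmetric_matrix M"
  shows "\<exists>b \<mu>. orthonormal_on {..<rank M} b \<and> span (b ` {..<rank M}) = range ((*v) M) \<and>
    (\<forall>i<rank M. M *v b i = \<mu> i *\<^sub>R b i) \<and> M = (\<Sum>i<rank M. \<mu> i *\<^sub>R outer (b i) (b i))"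
proof -
  note sa = symmetric_matrix_inner[OF M]
  have lin: "linear ((*v) M)" by simp
  have sub: "subspace (range ((*v) M))"
    using lin by (intro linear_subspace_image) auto
  have rk: "dim (range ((*v) M)) = rank M" by (simp add: rank_dim_range)
  obtain b where b: "orthonormal_on {..<rank M} b" "span (b ` {..<rank M}) = range ((*v) M)"
    "\<And>i j. i < rank M \<Longrightarrow> j < rank M \<Longrightarrow> i \<noteq> j \<Longrightarrow> inner (M *v b i) (b j) = 0"
    using diagonalize_on_subspace[OF lin sa sub] unfolding rk by blast
  define \<mu> where "\<mu> i = inner (M *v b i) (b i)" for i
  have eig: "M *v b i = \<mu> i *\<^sub>R b i" if "i < rank M" for i
  proof -
    have "M *v b i \<in> span (b ` {..<rank M})" unfolding b(2) by simp
    from orthonormal_expand[OF b(1) _ this]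
    have "M *v b i = (\<Sum>j<rank M. inner (b j) (M *v b i) *\<^sub>R b j)" by simp
    also have "\<dots> = (\<Sum>j<rank M. if j = i then \<mu> i *\<^sub>R b i else 0)"
      using b(3) that by (intro sum.cong) (auto simp: \<mu>_def inner_commute)
    finally show ?thesis using that by simp
  qed
  have "M *v x = (\<Sum>i<rank M. \<mu> i *\<^sub>R outer (b i) (b i)) *v x" for x
  proof -
    have "M *v x \<in> span (b ` {..<rank M})" unfolding b(2) by simp
    from orthonormal_expand[OF b(1) _ this]
    have "M *v x = (\<Sum>i<rank M. inner (b i) (M *v x) *\<^sub>R b i)" by simp
    also have "\<dots> = (\<Sum>i<rank M. (\<mu> i *\<^sub>R outer (b i) (b i)) *v x)"
      by (intro sum.cong) (auto simp: sa[symmetric] eig outer_mult_vec scaleR_matrix_vector_assoc[symmetric])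
    also have "\<dots> = (\<Sum>i<rank M. \<mu> i *\<^sub>R outer (b i) (b i)) *v x"
    proof -
      have "linear (\<lambda>A. A *v x)" by (auto intro!: linearI simp: matrix_vector_mult_add_rdistrib scaleR_matrix_vector_assoc)
      from linear_sum[OF this] show ?thesis by (rule sym)
    qed
    finally show ?thesis .
  qed
  then have M_eq: "M = (\<Sum>i<rank M. \<mu> i *\<^sub>R outer (b i) (b i))"
    unfolding matrix_eq by blast
  show ?thesis
    by (intro exI conjI allI impI) (rule b(1), rule b(2), erule eig, rule M_eq)
qed

subsection \<open>Distance between a diagonal matrix and a Gram matrix\<close>

abbreviation id_matrix :: "real^'n^'n" where
  "id_matrix \<equiv> Finite_Cartesian_Product.mat 1"

lemma orthogonal_matrix_norm:
  fixes W :: "real^'r^'r"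
  assumes "orthogonal_matrix W"
  shows "norm (transp W ** X ** W) = norm X" "norm (transp W *v x) = norm x"
proof -
  have W: "transp W ** W = id_matrix" "W ** transp W = id_matrix"
    using assms by (auto simp: orthogonal_matrix_def)
  have "inner (transp W ** X ** W) (transp W ** X ** W) =
      inner (transp W ** X) (transp W ** X ** (W ** transp W))"
    by (simp only: inner_matrix_mult_left matrix_mul_assoc)
  also have "\<dots> = inner X ((W ** transp W) ** X)"
    by (simp only: W matrix_mul_rid inner_matrix_mult_right
        Finite_Cartesian_Product.transpose_transpose matrix_mul_assoc)
  finally show "norm (transp W ** X ** W) = norm X" by (simp add: W norm_eq_sqrt_inner)
  have "orthogonal_matrix (transp W)" using assms by (simp add: orthogonal_matrix_transpose)
  then have "orthogonal_transformation ((*v) (transp W))"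
    by (simp add: orthogonal_transformation_matrix)
  then show "norm (transp W *v x) = norm x" by (rule orthogonal_transformation_norm)
qed

text \<open>The equation W^T W = 1 fixes the Frobenius norm of W, which gives boundedness.
  Compactness provides the maximizer in \<open>symmetrizing_rotation\<close>.\<close>

lemma compact_orthogonal_matrices: "compact {W :: real^'r^'r. orthogonal_matrix W}"
proof -
  have "continuous_on UNIV (\<lambda>W::real^'r^'r. transp W ** W)"
    by (intro bounded_bilinear.continuous_on[OF bounded_bilinear_matrix_mult]
        linear_continuous_on continuous_on_id)
      (simp add: linear_conv_bounded_linear[symmetric] linear_transp)
  then have "closed {W::real^'r^'r. transp W ** W = id_matrix}"
    by (intro closed_Collect_eq continuous_on_const) 
  moreover have "bounded {W::real^'r^'r. transp W ** W = id_matrix}"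
  proof (rule boundedI)
    fix W :: "real^'r^'r" assume "W \<in> {W. transp W ** W = id_matrix}"
    then show "norm W \<le> sqrt (trace (id_matrix :: real^'r^'r))"
      by (simp add: norm_eq_sqrt_inner inner_eq_trace)
  qed
  ultimately show ?thesis
    unfolding orthogonal_matrix compact_eq_bounded_closed by blast
qed

text \<open>The rotation of the (i, j) plane, written as the identity plus outer products so that
  its pairing with a matrix reads off individual entries. Keeping s as an argument of G expresses
  the transpose as the rotation with \<open>- s\<close>.\<close>

lemma orthogonal_givens:
  fixes i j :: "'r::finite"
  assumes ij: "i \<noteq> j" and cs: "c\<^sup>2 + s\<^sup>2 = 1"
  defines "G \<equiv> \<lambda>s. id_matrix + (c - 1) *\<^sub>R (outer (axis i 1) (axis i 1) + outer (axis j 1) (axis j 1))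
    + s *\<^sub>R (outer (axis i 1) (axis j 1) - outer (axis j 1) (axis i 1)) :: real^'r^'r"
  shows "orthogonal_matrix (G s)"
proof -
  have Gv: "G s *v x = x + ((c - 1) * x $ i + s * x $ j) *\<^sub>R axis i 1
      + ((c - 1) * x $ j - s * x $ i) *\<^sub>R axis j 1" for s x
    unfolding G_def
    by (simp add: matrix_vector_mult_add_rdistrib matrix_vector_mult_diff_rdistrib
        scaleR_matrix_vector_assoc[symmetric] outer_mult_vec inner_axis' algebra_simps)
  have "transp (G s) = G (- s)"
    by (simp add: G_def transp_add transp_diff transp_scaleR transp_outer
        Finite_Cartesian_Product.transpose_mat algebra_simps)
  moreover have "G (- s) *v (G s *v x) = x" for x
  proof -
    have Gk: "(G t *v y) $ k = (if k = i then c * y $ i + t * y $ j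
        else if k = j then c * y $ j - t * y $ i else y $ k)" for t y k
      using ij by (auto simp: Gv axis_def algebra_simps)
    have "c * (c * a + s * b) - s * (c * b - s * a) = a"
      "c * (c * b - s * a) + s * (c * a + s * b) = b" for a b
      using arg_cong[OF cs, of "\<lambda>t. t * a"] arg_cong[OF cs, of "\<lambda>t. t * b"]
      by (simp_all add: algebra_simps power2_eq_square)
    then have "(G (- s) *v (G s *v x)) $ k = x $ k" for k
      using ij by (simp add: Gk)
    then show ?thesis by (simp add: Finite_Cartesian_Product.vec_eq_iff)
  qed
  ultimately show ?thesis
    unfolding orthogonal_matrix by (simp add: matrix_eq matrix_vector_mul_assoc[symmetric])
qed

text \<open>A maximizer of \<open>W \<mapsto> tr (A W)\<close> over the orthogonal group works: by maximality under
  the rotations in each coordinate plane, \<open>A W\<close> has equal opposite entries.\<close>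

lemma symmetrizing_rotation:
  fixes A :: "real^'r^'r"
  obtains W where "orthogonal_matrix W" "symmetric_matrix (A ** W)"
proof -
  have "orthogonal_matrix (id_matrix :: real^'r^'r)" by (simp add: orthogonal_matrix_id)
  then have ne: "{W :: real^'r^'r. orthogonal_matrix W} \<noteq> {}" by blast
  have "continuous_on {W :: real^'r^'r. orthogonal_matrix W} (\<lambda>W. inner (transp A) W)"
    by (intro continuous_intros)
  from continuous_attains_sup[OF compact_orthogonal_matrices ne this]
  obtain W where W: "orthogonal_matrix W"
    and max: "\<And>V. orthogonal_matrix V \<Longrightarrow> inner (transp A) V \<le> inner (transp A) W" by blast
  define B where "B = A ** W"
  have maxB: "inner (transp B) G \<le> inner (transp B) (id_matrix)" if "orthogonal_matrix G" for G
  proof -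
    have *: "inner (transp A) (W ** V) = inner (transp B) V" for V
      using inner_matrix_mult_right[of W V "transp A"]
      by (simp add: B_def Finite_Cartesian_Product.matrix_transpose_mul inner_commute)
    show ?thesis using max[OF orthogonal_matrix_mul[OF W that]] *[of G] *[of "id_matrix"] by simp
  qed
  have "B $ i $ j = B $ j $ i" for i j
  proof (cases "i = j")
    case False
    define p where "p = B $ i $ i + B $ j $ j"
    define q where "q = B $ j $ i - B $ i $ j"
    have le: "c * p + s * q \<le> p" if "c\<^sup>2 + s\<^sup>2 = 1" for c s
    proof -
      have "inner (transp B) (outer (axis k 1) (axis m 1)) = B $ m $ k" for k m
        by (simp add: inner_matrix_outer inner_axis' matrix_vector_mult_basis column_def
            Finite_Cartesian_Product.transpose_def)
      with maxB[OF orthogonal_givens[OF False that]] show ?thesis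
        by (simp add: inner_add_right inner_diff_right p_def q_def algebra_simps)
    qed
    have "q = 0"
    proof (rule ccontr)
      assume "q \<noteq> 0"
      \<comment> \<open>The unit vector (p, q)/h gives c p + s q the value h, and h exceeds p unless
        q = 0.\<close>
      define h where "h = sqrt (p\<^sup>2 + q\<^sup>2)"
      have h2: "h\<^sup>2 = p\<^sup>2 + q\<^sup>2" by (simp add: h_def)
      have "h > 0" using \<open>q \<noteq> 0\<close> by (simp add: h_def sum_power2_gt_zero_iff)
      have "p / h * p + q / h * q \<le> p"
        by (rule le) (use \<open>h > 0\<close> in \<open>simp add: power_divide add_divide_distrib[symmetric] h2[symmetric]\<close>)
      then have "h\<^sup>2 \<le> p * h"
        using \<open>h > 0\<close> unfolding h2 by (simp add: field_simps power2_eq_square)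
      then have "h \<le> p" using \<open>h > 0\<close> by (simp add: power2_eq_square)
      then have "h\<^sup>2 \<le> p\<^sup>2" using \<open>h > 0\<close> by (intro power_mono) auto
      then show False using h2 \<open>q \<noteq> 0\<close> by simp
    qed
    then show ?thesis by (simp add: q_def)
  qed simp
  then have "symmetric_matrix B"
    by (simp add: symmetric_matrix_def Finite_Cartesian_Product.vec_eq_iff
        Finite_Cartesian_Product.transpose_def)
  with W show thesis unfolding B_def by (rule that)
qed

lemma transp_mult_outer_mult:
  "transp W ** outer x y ** (W :: real^'r^'r) = outer (transp W *v x) (transp W *v y)"
proof -
  have "inner y (W *v v) = inner (transp W *v y) v" for v
    by (simp add: dot_lmul_matrix transpose_matrix_vector)
  then show ?thesis
    by (simp add: matrix_eq matrix_vector_mul_assoc[symmetric] outer_mult_vec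
        matrix_vector_mult_scaleR)
qed

text \<open>Let W make A W symmetric. Then A A^T and W^T A^T A W are the same matrix R. With Q the
  rotated sum of the outer products, the right-hand side equals |R + Q - D|^2 + 2 <D,Q>, and the
  assumption on D bounds <D,Q> below by s times the sum of the |c_j|^2.\<close>

lemma diagonal_gram_distance:
  fixes A D :: "real^'r^'r" and c :: "'i \<Rightarrow> real^'r"
  assumes D: "\<And>x. s * (norm x)\<^sup>2 \<le> inner x (D *v x)"
  shows "2 * s * (\<Sum>j\<in>J. (norm (c j))\<^sup>2) \<le>
    (norm D)\<^sup>2 - 2 * inner D (A ** transp A) + (norm (transp A ** A + (\<Sum>j\<in>J. outer (c j) (c j))))\<^sup>2"
proof -
  obtain W where W: "orthogonal_matrix W" and sym: "symmetric_matrix (A ** W)"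
    by (rule symmetrizing_rotation)
  define R where "R = (A ** W) ** (A ** W)"
  define Q where "Q = (\<Sum>j\<in>J. outer (transp W *v c j) (transp W *v c j))"
  have t: "transp (A ** W) = A ** W" using sym by (simp add: symmetric_matrix_def)
  have "A ** transp A = A ** (W ** transp W) ** transp A"
    using W by (simp add: orthogonal_matrix_def)
  also have "\<dots> = (A ** W) ** transp (A ** W)"
    by (simp add: Finite_Cartesian_Product.matrix_transpose_mul matrix_mul_assoc)
  finally have 1: "A ** transp A = R" by (simp only: t R_def)
  have "transp W ** (transp A ** A) ** W = transp (A ** W) ** (A ** W)"
    by (simp add: Finite_Cartesian_Product.matrix_transpose_mul matrix_mul_assoc)
  then have 2: "transp W ** (transp A ** A) ** W = R" by (simp only: t R_def)
  have lin: "linear (\<lambda>X. transp W ** X ** W)"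
    using bounded_bilinear.bounded_linear_right[OF bounded_bilinear_matrix_mult, of "transp W"]
      bounded_bilinear.bounded_linear_left[OF bounded_bilinear_matrix_mult, of W]
    by (auto intro: bounded_linear.linear bounded_linear_compose)
  have "transp W ** (transp A ** A + (\<Sum>j\<in>J. outer (c j) (c j))) ** W = R + Q"
    by (simp only: linear_add[OF lin] linear_sum[OF lin] 2 Q_def transp_mult_outer_mult)
  then have 3: "norm (transp A ** A + (\<Sum>j\<in>J. outer (c j) (c j))) = norm (R + Q)"
    using orthogonal_matrix_norm(1)[OF W] by metis
  have "s * (\<Sum>j\<in>J. (norm (c j))\<^sup>2) = (\<Sum>j\<in>J. s * (norm (transp W *v c j))\<^sup>2)"
    by (simp only: orthogonal_matrix_norm(2)[OF W] sum_distrib_left)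
  also have "\<dots> \<le> inner D Q"
    unfolding Q_def inner_sum_right inner_matrix_outer by (intro sum_mono D)
  finally have "2 * s * (\<Sum>j\<in>J. (norm (c j))\<^sup>2) \<le> 2 * inner D Q" by simp
  also have "\<dots> \<le> (norm (R + Q - D))\<^sup>2 + 2 * inner D Q" by simp
  also have "\<dots> = (norm D)\<^sup>2 - 2 * inner D R + (norm (R + Q))\<^sup>2"
    unfolding power2_norm_eq_inner
    by (simp add: inner_add_left inner_add_right inner_diff_left inner_diff_right inner_commute)
  finally show ?thesis by (simp only: 1 3)
qed

subsection \<open>The system of conditions in terms of matrix entries\<close>

lemma inner_outer_sums:
  "inner (\<Sum>i\<in>I. \<sigma> i *\<^sub>R outer (q i) (q i)) (\<Sum>k\<in>K. outer (z k) (z k)) =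
    (\<Sum>i\<in>I. \<sigma> i * (\<Sum>k\<in>K. (inner (q i) (z k))\<^sup>2))"
  by (simp add: inner_sum_left inner_sum_right inner_outer power2_eq_square sum_distrib_left)
     (rule sum.swap)

lemma inner_orthonormal_outer_sums:
  assumes q: "orthonormal_on I q" and fin: "finite I"
  shows "inner (\<Sum>i\<in>I. \<sigma> i *\<^sub>R outer (q i) (q i)) (\<Sum>i\<in>I. \<tau> i *\<^sub>R outer (q i) (q i)) = (\<Sum>i\<in>I. \<sigma> i * \<tau> i)"
proof -
  have "inner (\<Sum>i\<in>I. \<sigma> i *\<^sub>R outer (q i) (q i)) (\<Sum>i\<in>I. \<tau> i *\<^sub>R outer (q i) (q i)) =
    (\<Sum>i\<in>I. \<Sum>j\<in>I. \<tau> i * (\<sigma> j * inner (outer (q j) (q j)) (outer (q i) (q i))))"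
    by (simp add: inner_sum_left inner_sum_right sum_distrib_left)
  also have "\<dots> = (\<Sum>i\<in>I. \<Sum>j\<in>I. if j = i then \<sigma> i * \<tau> i else 0)"
    by (intro sum.cong refl) (auto simp: inner_outer orthonormal_onD[OF q])
  finally show ?thesis using fin by simp
qed

lemma norm_gram_sum:
  "(norm (\<Sum>k\<in>K. outer (z k) (z k)))\<^sup>2 = (\<Sum>k\<in>K. \<Sum>k'\<in>K. (inner (z k) (z k'))\<^sup>2)"
  unfolding power2_norm_eq_inner
  by (simp add: inner_sum_left inner_sum_right inner_outer power2_eq_square inner_commute)

text \<open>An entry of A^T A + C^T C, the Gram matrix of the columns of A stacked on C. Its
  Frobenius norm collects the three block norms of the system.\<close>

definition gram_entry :: "nat \<Rightarrow> nat \<Rightarrow> real mat \<Rightarrow> real mat \<Rightarrow> nat \<Rightarrow> nat \<Rightarrow> real" where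
  "gram_entry r m A C k k' = (\<Sum>i<r. A $$ (i, k) * A $$ (i, k')) + (\<Sum>j<m. C $$ (j, k) * C $$ (j, k'))"

lemma index_mult_transpose:
  assumes "X \<in> carrier_mat a r" "Y \<in> carrier_mat b r" "i < a" "j < b"
  shows "(X * Y\<^sup>T) $$ (i, j) = (\<Sum>k<r. X $$ (i, k) * Y $$ (j, k))"
  using assms by (simp add: scalar_prod_def lessThan_atLeast0)

text \<open>Cyclicity of the trace: |X Y^T|^2 = <X^T X, Y^T Y>. Applied to the pairs (A, A), (A, C)
  and (C, C), it produces the terms of a binomial square in \<open>gram_entry\<close>.\<close>

lemma frobenius_norm_mult_transpose:
  assumes X: "X \<in> carrier_mat a r" and Y: "Y \<in> carrier_mat b r"
  shows "(frobenius_norm (X * Y\<^sup>T))\<^sup>2 =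
    (\<Sum>k<r. \<Sum>k'<r. (\<Sum>i<a. X $$ (i, k) * X $$ (i, k')) * (\<Sum>j<b. Y $$ (j, k) * Y $$ (j, k')))"
proof -
  have "(frobenius_norm (X * Y\<^sup>T))\<^sup>2 = (\<Sum>i<a. \<Sum>j<b. (\<Sum>k<r. X $$ (i, k) * Y $$ (j, k))\<^sup>2)"
  proof -
    have "(frobenius_norm (X * Y\<^sup>T))\<^sup>2 = (\<Sum>i<a. \<Sum>j<b. ((X * Y\<^sup>T) $$ (i, j))\<^sup>2)"
      unfolding frobenius_norm_def using X Y by (simp add: sum_nonneg)
    also have "\<dots> = (\<Sum>i<a. \<Sum>j<b. (\<Sum>k<r. X $$ (i, k) * Y $$ (j, k))\<^sup>2)"
      by (intro sum.cong refl) (simp only: lessThan_iff index_mult_transpose[OF X Y])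
    finally show ?thesis .
  qed
  also have "\<dots> = (\<Sum>i<a. \<Sum>j<b. \<Sum>k<r. \<Sum>k'<r. (X $$ (i, k) * X $$ (i, k')) * (Y $$ (j, k) * Y $$ (j, k')))"
    by (intro sum.cong refl) (simp add: power2_eq_square sum_product ac_simps)
  also have "\<dots> = (\<Sum>k<r. \<Sum>k'<r. \<Sum>i<a. \<Sum>j<b. (X $$ (i, k) * X $$ (i, k')) * (Y $$ (j, k) * Y $$ (j, k')))"
    by (simp only: sum.swap[of _ "{..<b}" "{..<r}"] sum.swap[of _ "{..<a}" "{..<r}"])
  finally show ?thesis by (simp only: sum_product)
qed

lemma mat_trace_diagonal_square:
  assumes "S \<in> carrier_mat r r" "diagonal_mat S"
  shows "mat_trace (S * S) = (\<Sum>i<r. (S $$ (i, i))\<^sup>2)"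
proof -
  have "(S * S) $$ (i, i) = (S $$ (i, i))\<^sup>2" if "i < r" for i
  proof -
    have "(S * S) $$ (i, i) = (\<Sum>k<r. S $$ (i, k) * S $$ (k, i))"
      using assms that by (simp add: scalar_prod_def lessThan_atLeast0)
    also have "\<dots> = (\<Sum>k<r. if k = i then (S $$ (i, i))\<^sup>2 else 0)"
      using assms that by (intro sum.cong) (auto simp: diagonal_mat_def power2_eq_square)
    finally show ?thesis using that by simp
  qed
  then show ?thesis using assms by (simp add: mat_trace_def)
qed

lemma mat_inner_diagonal_gram:
  assumes S: "S \<in> carrier_mat m m" "diagonal_mat S" and A: "A \<in> carrier_mat m r"
  shows "mat_inner S (A * A\<^sup>T) = (\<Sum>i<m. S $$ (i, i) * (\<Sum>k<r. (A $$ (i, k))\<^sup>2))"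
proof -
  have "(S\<^sup>T * (A * A\<^sup>T)) $$ (i, i) = S $$ (i, i) * (\<Sum>k<r. (A $$ (i, k))\<^sup>2)" if "i < m" for i
  proof -
    have "(S\<^sup>T * (A * A\<^sup>T)) $$ (i, i) = (\<Sum>k<m. S $$ (k, i) * (A * A\<^sup>T) $$ (k, i))"
      using S A that by (simp add: scalar_prod_def lessThan_atLeast0)
    also have "\<dots> = (\<Sum>k<m. if k = i then S $$ (i, i) * (A * A\<^sup>T) $$ (i, i) else 0)"
      using S that by (intro sum.cong) (auto simp: diagonal_mat_def)
    finally show ?thesis using that by (simp add: index_mult_transpose[OF A A that that] power2_eq_square)
  qed
  then show ?thesis using S by (simp add: mat_inner_def mat_trace_def)
qed

lemma mat_positive_definite_diagonal:
  assumes S: "S \<in> carrier_mat r r" "diagonal_mat S"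
  shows "mat_positive_definite S \<longleftrightarrow> (\<forall>i<r. 0 < S $$ (i, i))"
proof -
  have quad: "scalar_prod x (S *\<^sub>v x) = (\<Sum>i<r. S $$ (i, i) * (x $ i)\<^sup>2)" if x: "x \<in> carrier_vec r" for x
  proof -
    have "(S *\<^sub>v x) $ i = S $$ (i, i) * x $ i" if "i < r" for i
    proof -
      have "(S *\<^sub>v x) $ i = (\<Sum>k<r. S $$ (i, k) * x $ k)"
        using S x that by (simp add: scalar_prod_def lessThan_atLeast0)
      also have "\<dots> = (\<Sum>k<r. if k = i then S $$ (i, i) * x $ i else 0)"
        using S that by (intro sum.cong) (auto simp: diagonal_mat_def)
      finally show ?thesis using that by simp
    qed
    then show ?thesis using S x
      by (simp add: scalar_prod_def lessThan_atLeast0 power2_eq_square ac_simps)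
  qed
  show ?thesis
  proof
    assume P: "mat_positive_definite S"
    show "\<forall>i<r. 0 < S $$ (i, i)"
    proof (intro allI impI)
      fix i assume i: "i < r"
      have "unit_vec r i \<noteq> (0\<^sub>v r :: real Matrix.vec)"
        using i by (auto dest: arg_cong[where f = "\<lambda>v. v $ i"])
      then have "0 < scalar_prod (unit_vec r i) (S *\<^sub>v unit_vec r i)"
        using P S by (auto simp: mat_positive_definite_def)
      also have "\<dots> = (\<Sum>k<r. if k = i then S $$ (i, i) else 0)"
        unfolding quad[OF unit_vec_carrier] using i by (intro sum.cong) auto
      finally show "0 < S $$ (i, i)" using i by simp
    qed
  next
    assume P: "\<forall>i<r. 0 < S $$ (i, i)"
    have "S $$ (j, i) = S $$ (i, j)" if "i < r" "j < r" for i j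
      using S that by (cases "i = j") (auto simp: diagonal_mat_def)
    then have "S\<^sup>T = S" using S by (intro eq_matI) auto
    moreover have "0 < scalar_prod x (S *\<^sub>v x)" if x: "x \<in> carrier_vec r" "x \<noteq> 0\<^sub>v r" for x
    proof -
      obtain i where i: "i < r" "x $ i \<noteq> 0"
      proof (rule ccontr)
        assume "\<not> thesis"
        then have "x = 0\<^sub>v r" using that x(1) by (intro eq_vecI) auto
        then show False using x(2) by simp
      qed
      have "0 < (\<Sum>i<r. S $$ (i, i) * (x $ i)\<^sup>2)"
        using P i by (intro sum_pos2[of _ i]) (auto intro: mult_nonneg_nonneg less_imp_le)
      then show ?thesis using quad x by simp
    qed
    ultimately show "mat_positive_definite S" using S by (simp add: mat_positive_definite_def)
  qed
qed

lemma Max_le_mult_Min_iff: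
  fixes a :: real
  assumes "finite I" "I \<noteq> {}" "finite J" "J \<noteq> {}" "0 \<le> a"
  shows "a * Min (f ` I) \<ge> Max (g ` J) \<longleftrightarrow> (\<forall>i\<in>I. \<forall>j\<in>J. g j \<le> a * f i)"
proof
  assume le: "a * Min (f ` I) \<ge> Max (g ` J)"
  show "\<forall>i\<in>I. \<forall>j\<in>J. g j \<le> a * f i"
  proof (intro ballI)
    fix i j assume "i \<in> I" "j \<in> J"
    then have "g j \<le> Max (g ` J)" "Min (f ` I) \<le> f i" using assms by auto
    with le mult_left_mono[OF this(2) \<open>0 \<le> a\<close>] show "g j \<le> a * f i" by linarith
  qed
next
  assume le: "\<forall>i\<in>I. \<forall>j\<in>J. g j \<le> a * f i"
  obtain i where "i \<in> I" "Min (f ` I) = f i"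
    using Min_in[of "f ` I"] assms(1,2) by blast
  then show "a * Min (f ` I) \<ge> Max (g ` J)"
    using le assms(3,4) by (subst Max_le_iff) auto
qed

text \<open>Both directions handle the system through this scalar form. Since \<open>0 < r\<close>,
  the minimum is over a nonempty set, and for \<open>l \<le> r\<close> both versions of the order
  condition are vacuous.\<close>

lemma conditions_iff:
  assumes r: "0 < r" and \<delta>: "0 \<le> \<delta>" and car: "S \<in> carrier_mat r r" "L \<in> carrier_mat (l - r) (l - r)"
    "A \<in> carrier_mat r r" "C \<in> carrier_mat (l - r) r" "diagonal_mat S" "diagonal_mat L"
  defines "\<sigma> \<equiv> \<lambda>i. S $$ (i, i)" and "\<mu> \<equiv> \<lambda>j. L $$ (j, j)"
  defines "p \<equiv> (\<Sum>j<l - r. \<mu> j * (\<Sum>k<r. (C $$ (j, k))\<^sup>2))"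
  shows "conditions r l \<delta> \<alpha> S L A C \<longleftrightarrow>
    1 - \<delta> < \<alpha> \<and> \<alpha> \<le> (1 + \<delta>) / 2 \<and>
    (\<forall>i<r. \<forall>j<l - r. \<mu> j \<le> (1 + \<delta>) * \<sigma> i) \<and> (\<forall>i<r. 0 < \<sigma> i) \<and>
    p = \<alpha> * ((\<Sum>i<r. (\<sigma> i)\<^sup>2) - 2 * (\<Sum>i<r. \<sigma> i * (\<Sum>k<r. (A $$ (i, k))\<^sup>2))
      + (\<Sum>k<r. \<Sum>k'<r. (gram_entry r (l - r) A C k k')\<^sup>2)) \<and>
    (\<Sum>j<l - r. (\<mu> j)\<^sup>2) \<le> inverse \<alpha> * (2 * \<alpha> - 1 + \<delta>\<^sup>2) * p \<and> p \<noteq> 0"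
proof -
  have frob: "(frobenius_norm (A * A\<^sup>T))\<^sup>2 + 2 * (frobenius_norm (A * C\<^sup>T))\<^sup>2 + (frobenius_norm (C * C\<^sup>T))\<^sup>2
      = (\<Sum>k<r. \<Sum>k'<r. (gram_entry r (l - r) A C k k')\<^sup>2)"
  proof -
    have sq: "(x + y)\<^sup>2 = x * x + 2 * (x * y) + y * y" for x y :: real
      by (simp add: power2_eq_square algebra_simps)
    show ?thesis
      unfolding frobenius_norm_mult_transpose[OF car(3,3)] frobenius_norm_mult_transpose[OF car(3,4)]
        frobenius_norm_mult_transpose[OF car(4,4)] gram_entry_def sq sum.distrib sum_distrib_left ..
  qed
  have frob': "x + (frobenius_norm (A * A\<^sup>T))\<^sup>2 + 2 * (frobenius_norm (A * C\<^sup>T))\<^sup>2 + (frobenius_norm (C * C\<^sup>T))\<^sup>2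
      = x + (\<Sum>k<r. \<Sum>k'<r. (gram_entry r (l - r) A C k k')\<^sup>2)" for x
    using frob by simp
  have ord: "(r < l \<longrightarrow> (1 + \<delta>) * Min (\<sigma> ` {..<r}) \<ge> Max (\<mu> ` {..<l - r})) \<longleftrightarrow>
      (\<forall>i<r. \<forall>j<l - r. \<mu> j \<le> (1 + \<delta>) * \<sigma> i)"
  proof (cases "r < l")
    case True
    then have "{..<r} \<noteq> {}" "{..<l - r} \<noteq> {}" using r by (simp_all add: lessThan_empty_iff)
    then show ?thesis
      using Max_le_mult_Min_iff[of "{..<r}" "{..<l - r}" "1 + \<delta>" \<mu> \<sigma>] True \<delta>
      by (simp add: Ball_def)
  qed auto
  show ?thesis
    unfolding conditions_def frob' mat_inner_diagonal_gram[OF car(1,5,3)]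
      mat_inner_diagonal_gram[OF car(2,6,4)] mat_trace_diagonal_square[OF car(1,5)]
      mat_trace_diagonal_square[OF car(2,6)] mat_positive_definite_diagonal[OF car(1,5)]
    unfolding p_def \<sigma>_def \<mu>_def
    by (simp only: car ord[unfolded \<sigma>_def \<mu>_def] simp_thms)
qed

text \<open>The two sides of the system are norms and inner products of block matrices in the
  orthonormal frame \<open>q\<close>: the difference \<open>U U\<^sup>T - Z Z\<^sup>T\<close> and the compressed gradient.\<close>

definition frame_difference ::
  "nat \<Rightarrow> (nat \<Rightarrow> real) \<Rightarrow> (nat \<Rightarrow> real^'n) \<Rightarrow> (nat \<Rightarrow> real^'n) \<Rightarrow> real^'n^'n" where
  "frame_difference r \<sigma> q z = (\<Sum>i<r. \<sigma> i *\<^sub>R outer (q i) (q i)) - (\<Sum>k<r. outer (z k) (z k))"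

text \<open>The lower diagonal block of the frame difference is - C C^T. The minus sign here cancels
  that one, so the inner product of the two matrices is <Lambda, C C^T>.\<close>

definition frame_gradient :: "nat \<Rightarrow> nat \<Rightarrow> (nat \<Rightarrow> real) \<Rightarrow> (nat \<Rightarrow> real^'n) \<Rightarrow> real^'n^'n" where
  "frame_gradient r m \<mu> q = - (\<Sum>j<m. \<mu> j *\<^sub>R outer (q (r + j)) (q (r + j)))"

lemma orthonormal_shift:
  assumes "orthonormal_on {..<r + m :: nat} q"
  shows "orthonormal_on {..<m} (\<lambda>j. q (r + j))"
  unfolding orthonormal_on_def using orthonormal_onD[OF assms] by simp

lemma norm_frame_difference:
  assumes q: "orthonormal_on {..<r} q"
  shows "(norm (frame_difference r \<sigma> q z))\<^sup>2 = (\<Sum>i<r. (\<sigma> i)\<^sup>2)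
    - 2 * (\<Sum>i<r. \<sigma> i * (\<Sum>k<r. (inner (q i) (z k))\<^sup>2)) + (\<Sum>k<r. \<Sum>k'<r. (inner (z k) (z k'))\<^sup>2)"
  using norm_gram_sum[of z "{..<r}"] inner_orthonormal_outer_sums[OF q finite_lessThan, of \<sigma> \<sigma>]
    inner_outer_sums[of \<sigma> q "{..<r}" z "{..<r}"]
  unfolding frame_difference_def power2_norm_eq_inner power2_eq_square[of "\<sigma> _"]
  by (simp add: inner_diff_left inner_diff_right inner_commute)

lemma norm_frame_gradient:
  assumes q: "orthonormal_on {..<r + m} q"
  shows "(norm (frame_gradient r m \<mu> q))\<^sup>2 = (\<Sum>j<m. (\<mu> j)\<^sup>2)"
  using inner_orthonormal_outer_sums[OF orthonormal_shift[OF q] finite_lessThan, of \<mu> \<mu>]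
  unfolding frame_gradient_def norm_minus_cancel power2_norm_eq_inner by (simp add: power2_eq_square)

lemma inner_frame_gradient_difference:
  assumes q: "orthonormal_on {..<r + m} q"
  shows "inner (frame_gradient r m \<mu> q) (frame_difference r \<sigma> q z) =
    (\<Sum>j<m. \<mu> j * (\<Sum>k<r. (inner (q (r + j)) (z k))\<^sup>2))"
proof -
  have "inner (outer (q (r + j)) (q (r + j))) (\<Sum>i<r. \<sigma> i *\<^sub>R outer (q i) (q i)) = 0" if "j < m" for j
    unfolding inner_sum_right using orthonormal_onD[OF q] that
    by (intro sum.neutral) (simp add: inner_outer)
  then have "inner (\<Sum>j<m. \<mu> j *\<^sub>R outer (q (r + j)) (q (r + j))) (\<Sum>i<r. \<sigma> i *\<^sub>R outer (q i) (q i)) = 0"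
    by (simp add: inner_sum_left)
  then show ?thesis
    using inner_outer_sums[of \<mu> "\<lambda>j. q (r + j)" "{..<m}" z "{..<r}"]
    by (simp add: frame_gradient_def frame_difference_def inner_diff_right)
qed

lemma inner_span_frame:
  assumes q: "orthonormal_on {..<r + m :: nat} q" and z: "z k \<in> span (q ` {..<r + m})" "z k' \<in> span (q ` {..<r + m})"
  shows "inner (z k) (z k') = (\<Sum>i<r. inner (q i) (z k) * inner (q i) (z k')) +
    (\<Sum>j<m. inner (q (r + j)) (z k) * inner (q (r + j)) (z k'))"
proof -
  have "inner (z k) (z k') = inner (\<Sum>i<r + m. inner (q i) (z k) *\<^sub>R q i) (z k')"
    using orthonormal_expand[OF q finite_lessThan z(1)] by (rule arg_cong)
  also have "\<dots> = (\<Sum>i<r + m. inner (q i) (z k) * inner (q i) (z k'))"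
    by (simp add: inner_sum_left)
  also have "\<dots> = (\<Sum>i<r. inner (q i) (z k) * inner (q i) (z k')) +
    (\<Sum>j<m. inner (q (r + j)) (z k) * inner (q (r + j)) (z k'))"
    using sum.atLeastLessThan_concat[of 0 r "r + m" "\<lambda>i. inner (q i) (z k) * inner (q i) (z k')"]
      sum.shift_bounds_nat_ivl[of "\<lambda>i. inner (q i) (z k) * inner (q i) (z k')" 0 r m]
    by (simp add: lessThan_atLeast0 add.commute)
  finally show ?thesis .
qed

lemma frame_gradient_mult_vec:
  fixes q :: "nat \<Rightarrow> real^'n"
  shows "frame_gradient r m \<mu> q *v v = - (\<Sum>j<m. (\<mu> j * inner (q (r + j)) v) *\<^sub>R q (r + j))"
  unfolding frame_gradient_def
  using sum_outer_mult_vec[of \<mu> "\<lambda>j. q (r + j)" "\<lambda>j. q (r + j)" "{..<m}" v]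
  by (simp add: minus_mult_vec)

subsection \<open>From a frame to a solution of the system\<close>

lemma sum_UNIV_bij_betw:
  assumes "bij_betw idx UNIV {..<r :: nat}"
  shows "(\<Sum>k\<in>UNIV. h (idx k)) = (\<Sum>k<r. h k)"
  using sum.reindex_bij_betw[OF assms] by simp

text \<open>Transfers \<open>diagonal_gram_distance\<close> to entries indexed by natural numbers:
  the orthogonal group lives on the type \<open>real^'r^'r\<close>, while the system is indexed by
  numbers, and \<open>idx\<close> translates.\<close>

lemma diagonal_gram_distance_entries:
  fixes idx :: "'r::finite \<Rightarrow> nat" and a c :: "nat \<Rightarrow> nat \<Rightarrow> real"
  assumes idx: "bij_betw idx UNIV {..<r}" and s: "\<And>i. i < r \<Longrightarrow> s \<le> \<sigma> i"
  shows "2 * s * (\<Sum>j<m. \<Sum>k<r. (c j k)\<^sup>2) \<le> (\<Sum>i<r. (\<sigma> i)\<^sup>2)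
    - 2 * (\<Sum>i<r. \<sigma> i * (\<Sum>k<r. (a i k)\<^sup>2))
    + (\<Sum>k<r. \<Sum>k'<r. ((\<Sum>i<r. a i k * a i k') + (\<Sum>j<m. c j k * c j k'))\<^sup>2)"
proof -
  note re = sum_UNIV_bij_betw[OF idx]
  have inj: "idx i = idx j \<longleftrightarrow> i = j" for i j
    using bij_betw_imp_inj_on[OF idx] by (auto dest: injD)
  have lt: "idx i < r" for i using bij_betwE[OF idx] by auto
  define A :: "real^'r^'r" where "A = (\<chi> i k. a (idx i) (idx k))"
  define D :: "real^'r^'r" where "D = (\<chi> i k. if k = i then \<sigma> (idx i) else 0)"
  define C :: "nat \<Rightarrow> real^'r" where "C j = (\<chi> k. c j (idx k))" for j
  have Dv: "(D *v x) $ i = \<sigma> (idx i) * x $ i" for x i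
  proof -
    have "(D *v x) $ i = (\<Sum>k\<in>UNIV. (if k = i then \<sigma> (idx i) else 0) * x $ k)"
      by (simp add: D_def matrix_vector_mult_def)
    also have "\<dots> = (\<Sum>k\<in>UNIV. if k = i then \<sigma> (idx i) * x $ i else 0)"
      by (intro sum.cong) auto
    finally show ?thesis by simp
  qed
  have "s * (norm x)\<^sup>2 \<le> inner x (D *v x)" for x
  proof -
    have "s * (norm x)\<^sup>2 = (\<Sum>i\<in>UNIV. s * (x $ i)\<^sup>2)"
      unfolding power2_norm_eq_inner by (simp add: inner_vec_def sum_distrib_left power2_eq_square)
    also have "\<dots> \<le> (\<Sum>i\<in>UNIV. \<sigma> (idx i) * (x $ i)\<^sup>2)"
      using s[OF lt] by (intro sum_mono mult_right_mono) auto
    also have "\<dots> = inner x (D *v x)"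
      by (simp add: inner_vec_def Dv power2_eq_square ac_simps)
    finally show ?thesis .
  qed
  from diagonal_gram_distance[OF this, where c = C and J = "{..<m}" and A = A]
  have "2 * s * (\<Sum>j<m. (norm (C j))\<^sup>2) \<le> (norm D)\<^sup>2 - 2 * inner D (A ** transp A)
    + (norm (transp A ** A + (\<Sum>j<m. outer (C j) (C j))))\<^sup>2" .
  moreover have "(norm (C j))\<^sup>2 = (\<Sum>k<r. (c j k)\<^sup>2)" for j
    unfolding power2_norm_eq_inner inner_vec_def re[symmetric]
    by (simp add: C_def power2_eq_square)
  moreover have "(norm D)\<^sup>2 = (\<Sum>i<r. (\<sigma> i)\<^sup>2)"
  proof -
    have "inner (D $ i) (D $ i) = (\<Sum>k\<in>UNIV. if k = i then (\<sigma> (idx i))\<^sup>2 else 0)" for i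
      unfolding D_def inner_vec_def by (intro sum.cong) (auto simp: power2_eq_square)
    then show ?thesis unfolding power2_norm_eq_inner inner_vec_def[of D] re[symmetric] by simp
  qed
  moreover have "inner D (A ** transp A) = (\<Sum>i<r. \<sigma> i * (\<Sum>k<r. (a i k)\<^sup>2))"
  proof -
    have "inner (D $ i) ((A ** transp A) $ i) =
        (\<Sum>j\<in>UNIV. if j = i then \<sigma> (idx i) * (A ** transp A) $ i $ i else 0)" for i
      unfolding D_def inner_vec_def by (intro sum.cong) auto
    moreover have "(A ** transp A) $ i $ i = (\<Sum>k\<in>UNIV. (a (idx i) (idx k))\<^sup>2)" for i
      by (simp add: A_def matrix_matrix_mult_def Finite_Cartesian_Product.transpose_def power2_eq_square)
    ultimately show ?thesis unfolding inner_vec_def[of D] re[symmetric] by simp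
  qed
  moreover have "(norm (transp A ** A + (\<Sum>j<m. outer (C j) (C j))))\<^sup>2 =
      (\<Sum>k<r. \<Sum>k'<r. ((\<Sum>i<r. a i k * a i k') + (\<Sum>j<m. c j k * c j k'))\<^sup>2)"
  proof -
    have "(transp A ** A + (\<Sum>j<m. outer (C j) (C j))) $ k $ k' =
        (\<Sum>i\<in>UNIV. a (idx i) (idx k) * a (idx i) (idx k')) + (\<Sum>j<m. c j (idx k) * c j (idx k'))" for k k'
      by (simp add: A_def C_def matrix_matrix_mult_def Finite_Cartesian_Product.transpose_def outer_def)
    then show ?thesis
      unfolding power2_norm_eq_inner inner_vec_def re[symmetric] by (simp add: power2_eq_square)
  qed
  ultimately show ?thesis by simp
qed

lemma independent_orthonormal:
  assumes q: "orthonormal_on I q"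
  shows "inj_on q I" "independent (q ` I)"
proof -
  show "inj_on q I"
    using orthonormal_onD[OF q] by (auto intro!: inj_onI) (metis zero_neq_one)
  have "x \<noteq> 0" if "x \<in> q ` I" for x
    using that orthonormal_onD[OF q] by (metis imageE inner_zero_left zero_neq_one)
  then show "independent (q ` I)"
    using orthonormal_onD[OF q]
    by (intro pairwise_orthogonal_independent)
      (force simp: pairwise_def Linear_Algebra.orthogonal_def)+
qed

lemma dim_orthonormal:
  fixes q :: "'i \<Rightarrow> 'a::euclidean_space"
  assumes "orthonormal_on I q"
  shows "dim (span (q ` I)) = card I"
  using independent_orthonormal[OF assms] indep_card_eq_dim_span[of "q ` I"] by (simp add: card_image)

text \<open>The lower bound on \<open>\<alpha>\<close> is strict because equality forces the compressed gradient to be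
  \<open>(1 - \<delta>)\<close> times the difference; then \<open>q\<^sub>0, \<dots>, q\<^sub>r\<^sub>-\<^sub>1\<close> lie in the span of the \<open>z\<^sub>k\<close>, whose
  components along the other \<open>q\<^sub>j\<close> therefore vanish.\<close>

lemma conditions_of_frame:
  fixes idx :: "'r::finite \<Rightarrow> nat" and q z :: "nat \<Rightarrow> real^'n"
  assumes idx: "bij_betw idx UNIV {..<r}" and r: "0 < r" and \<delta>: "0 \<le> \<delta>" "\<delta> < 1"
    and q: "orthonormal_on {..<r + m} q" and z: "\<And>k. k < r \<Longrightarrow> z k \<in> span (q ` {..<r + m})"
    and \<sigma>: "\<And>i. i < r \<Longrightarrow> 0 < \<sigma> i"
    and ord: "\<And>i j. i < r \<Longrightarrow> j < m \<Longrightarrow> \<mu> j \<le> (1 + \<delta>) * \<sigma> i"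
  defines "K \<equiv> frame_difference r \<sigma> q z" and "G \<equiv> frame_gradient r m \<mu> q"
  assumes K: "K \<noteq> 0" and coco: "(1 - \<delta>\<^sup>2) * (norm K)\<^sup>2 + (norm G)\<^sup>2 \<le> 2 * inner G K"
  shows "\<exists>\<alpha> S L A C. conditions r (r + m) \<delta> \<alpha> S L A C"
proof -
  define a where "a i k = inner (q i) (z k)" for i k
  define c where "c j k = inner (q (r + j)) (z k)" for j k
  define A where "A = Matrix.mat r r (\<lambda>(i, k). a i k)"
  define C where "C = Matrix.mat m r (\<lambda>(j, k). c j k)"
  define S where "S = Matrix.mat r r (\<lambda>(i, k). if i = k then \<sigma> i else 0)"
  define L where "L = Matrix.mat m m (\<lambda>(i, k). if i = k then \<mu> i else 0)"
  define p where "p = inner G K"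
  define N where "N = (norm K)\<^sup>2"
  \<comment> \<open>The equation of the system reads p = \<alpha> N, so this value is
    forced.\<close>
  define \<alpha> where "\<alpha> = p / N"
  have car: "S \<in> carrier_mat r r" "L \<in> carrier_mat (r + m - r) (r + m - r)" "A \<in> carrier_mat r r"
    "C \<in> carrier_mat (r + m - r) r" "diagonal_mat S" "diagonal_mat L"
    by (auto simp: S_def L_def A_def C_def diagonal_mat_def)
  have "N > 0" using K by (simp add: N_def)
  have p\<alpha>: "p = \<alpha> * N" using \<open>N > 0\<close> by (simp add: \<alpha>_def)
  have "0 < (1 - \<delta>\<^sup>2) * N" using \<open>N > 0\<close> \<delta> by (simp add: power_less_one_iff abs_square_less_1)
  then have "p > 0" using coco unfolding p_def[symmetric] N_def[symmetric]
    using zero_le_power2[of "norm G"] by linarith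
  then have "\<alpha> > 0" using \<open>N > 0\<close> by (simp add: \<alpha>_def)
  have q': "orthonormal_on {..<r} q" using q by (rule orthonormal_on_subset) auto
  have gram: "inner (z k) (z k') = (\<Sum>i<r. a i k * a i k') + (\<Sum>j<m. c j k * c j k')"
    if "k < r" "k' < r" for k k'
    unfolding a_def c_def by (rule inner_span_frame[OF q]) (use z that in auto)
  have N: "N = (\<Sum>i<r. (\<sigma> i)\<^sup>2) - 2 * (\<Sum>i<r. \<sigma> i * (\<Sum>k<r. (a i k)\<^sup>2))
      + (\<Sum>k<r. \<Sum>k'<r. ((\<Sum>i<r. a i k * a i k') + (\<Sum>j<m. c j k * c j k'))\<^sup>2)"
    using norm_frame_difference[OF q', of \<sigma> z] by (simp add: N_def K_def gram a_def[symmetric])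
  have p: "p = (\<Sum>j<m. \<mu> j * (\<Sum>k<r. (c j k)\<^sup>2))"
    unfolding p_def G_def K_def inner_frame_gradient_difference[OF q] c_def ..
  have G: "(norm G)\<^sup>2 = (\<Sum>j<m. (\<mu> j)\<^sup>2)" unfolding G_def by (rule norm_frame_gradient[OF q])
  \<comment> \<open>Here 2 s X <= N and p <= (1 + \<delta>) s X with p = \<alpha> N. Positivity of p
    makes s X positive, and cancelling it leaves 2 \<alpha> <= 1 + \<delta>.\<close>
  have upper: "\<alpha> \<le> (1 + \<delta>) / 2"
  proof -
    define s where "s = Min (\<sigma> ` {..<r})"
    define X where "X = (\<Sum>j<m. \<Sum>k<r. (c j k)\<^sup>2)"
    have s: "s \<in> \<sigma> ` {..<r}" "\<And>i. i < r \<Longrightarrow> s \<le> \<sigma> i"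
      unfolding s_def using r by (auto intro!: Min_in simp: lessThan_empty_iff)
    have "2 * s * X \<le> N"
      unfolding N X_def by (rule diagonal_gram_distance_entries[OF idx s(2)])
    then have "\<alpha> * (2 * s * X) \<le> p" using \<open>\<alpha> > 0\<close> p\<alpha> by simp
    moreover have "p \<le> (1 + \<delta>) * s * X"
      unfolding p X_def sum_distrib_left[of _ _ "{..<m}"] using s(1) ord
      by (intro sum_mono mult_right_mono sum_nonneg) auto
    ultimately have "\<alpha> * (2 * s * X) \<le> (1 + \<delta>) * s * X" "0 < (1 + \<delta>) * s * X"
      using \<open>p > 0\<close> by linarith+
    then have "(2 * \<alpha>) * (s * X) \<le> (1 + \<delta>) * (s * X)" "0 < s * X"
      using \<delta> zero_less_mult_pos[of "1 + \<delta>" "s * X"] by (simp_all add: ac_simps)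
    then show ?thesis by (simp add: mult_le_cancel_right)
  qed
  have lower: "1 - \<delta> < \<alpha>"
  proof (rule ccontr)
    assume "\<not> 1 - \<delta> < \<alpha>"
    \<comment> \<open>By \<open>coco\<close> this square is at most 2 \<delta> N (\<alpha> - (1 -
      \<delta>)), so \<alpha> <= 1 - \<delta> forces it to vanish.\<close>
    have "(norm (G - (1 - \<delta>) *\<^sub>R K))\<^sup>2 = (norm G)\<^sup>2 - 2 * (1 - \<delta>) * p + (1 - \<delta>)\<^sup>2 * N"
      unfolding p_def N_def power2_norm_eq_inner
      by (simp add: inner_diff_left inner_diff_right inner_commute power2_eq_square algebra_simps)
    also have "\<dots> \<le> (2 * p - (1 - \<delta>\<^sup>2) * N) - 2 * (1 - \<delta>) * p + (1 - \<delta>)\<^sup>2 * N"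
      using coco by (simp add: p_def N_def)
    also have "\<dots> = 2 * \<delta> * (N * (\<alpha> - (1 - \<delta>)))"
      unfolding p\<alpha> by (simp add: power2_eq_square algebra_simps)
    also have "\<dots> \<le> 0"
      using \<open>\<not> 1 - \<delta> < \<alpha>\<close> \<delta> \<open>N > 0\<close> by (simp add: mult_nonneg_nonpos)
    finally have GK: "G = (1 - \<delta>) *\<^sub>R K" by simp
    have "q i \<in> span (z ` {..<r})" if "i < r" for i
    proof -
      have "G *v q i = 0"
        unfolding G_def frame_gradient_mult_vec using orthonormal_onD[OF q] that by simp
      then have "K *v q i = 0" using \<delta> unfolding GK by (simp add: scaleR_matrix_vector_assoc[symmetric])
      moreover have "K *v q i = \<sigma> i *\<^sub>R q i - (\<Sum>k<r. inner (z k) (q i) *\<^sub>R z k)"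
      proof -
        have "(\<Sum>k<r. (\<sigma> k * inner (q k) (q i)) *\<^sub>R q k) = (\<Sum>k<r. if k = i then \<sigma> i *\<^sub>R q i else 0)"
          using orthonormal_onD[OF q'] that by (intro sum.cong) auto
        then show ?thesis
          using that
          by (simp add: K_def frame_difference_def matrix_vector_mult_diff_rdistrib sum_outer_mult_vec
              sum_outer_mult_vec')
      qed
      ultimately have "\<sigma> i *\<^sub>R q i = (\<Sum>k<r. inner (z k) (q i) *\<^sub>R z k)" by simp
      also have "\<dots> \<in> span (z ` {..<r})"
        by (intro span_scale span_sum span_base) auto
      finally have "(1 / \<sigma> i) *\<^sub>R (\<sigma> i *\<^sub>R q i) \<in> span (z ` {..<r})"
        by (rule span_scale)
      then show ?thesis using \<sigma>[OF that] by simp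
    qed
    then have "span (q ` {..<r}) \<subseteq> span (z ` {..<r})"
      by (intro span_minimal) auto
    \<comment> \<open>At most r vectors span the larger space, while the smaller one has dimension
      r; the inclusion is therefore an equality, which places each z_k in the span of the first r
      frame vectors.\<close>
    moreover have "dim (span (z ` {..<r})) \<le> dim (span (q ` {..<r}))"
      using dim_le_card'[of "z ` {..<r}"] card_image_le[of "{..<r}" z]
      unfolding dim_orthonormal[OF q'] by (simp add: dim_span)
    ultimately have "span (q ` {..<r}) = span (z ` {..<r})"
      by (intro subspace_dim_equal) auto
    then have zq: "z k \<in> span (q ` {..<r})" if "k < r" for k
      using that by (metis image_eqI lessThan_iff span_base)
    have "c j k = 0" if "j < m" "k < r" for j k
    proof -
      have "inner (q (r + j)) x = 0" if "x \<in> span (q ` {..<r})" for x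
      proof -
        have "inner (q (r + j)) y = 0" if "y \<in> q ` {..<r}" for y
          using that orthonormal_onD[OF q, of "r + j"] \<open>j < m\<close> by auto
        then show ?thesis
          using orthogonal_to_span[OF that, of "q (r + j)"] by (simp add: Linear_Algebra.orthogonal_def)
      qed
      then show ?thesis using zq[OF \<open>k < r\<close>] by (simp add: c_def)
    qed
    then have "p = 0" unfolding p by simp
    with \<open>p > 0\<close> show False by simp
  qed
  \<comment> \<open>Since p = \<alpha> N, the right-hand side is 2 p - (1 - \<delta>^2) N, and the
    claim is \<open>coco\<close> in the notation of the system.\<close>
  have trace: "(\<Sum>j<m. (\<mu> j)\<^sup>2) \<le> inverse \<alpha> * (2 * \<alpha> - 1 + \<delta>\<^sup>2) * p"
  proof -
    have "inverse \<alpha> * (2 * \<alpha> - 1 + \<delta>\<^sup>2) * p = 2 * p - (1 - \<delta>\<^sup>2) * N"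
      using \<open>\<alpha> > 0\<close> by (simp add: p\<alpha> field_simps)
    then show ?thesis using coco G by (simp add: p_def N_def)
  qed
  have "conditions r (r + m) \<delta> \<alpha> S L A C"
    unfolding conditions_iff[OF r \<delta>(1) car]
    using lower upper ord \<sigma> p p\<alpha> N trace \<open>p > 0\<close>
    by (simp add: S_def L_def A_def C_def gram_entry_def)
  then show ?thesis by blast
qed

subsection \<open>Necessity\<close>

lemma rank_add_le:
  fixes A B :: "real^'n^'m"
  shows "rank (A + B) \<le> rank A + rank B"
proof -
  let ?R = "\<lambda>A :: real^'n^'m. range ((*v) A)"
  have sub: "subspace (?R A)" for A :: "real^'n^'m"
    by (intro linear_subspace_image) auto
  have "?R (A + B) \<subseteq> {x + y |x y. x \<in> ?R A \<and> y \<in> ?R B}"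
    by (auto simp: matrix_vector_mult_add_rdistrib)
  then have "dim (?R (A + B)) \<le> dim {x + y |x y. x \<in> ?R A \<and> y \<in> ?R B}"
    by (rule dim_subset)
  with dim_sums_Int[OF sub sub, of A B] show ?thesis by (simp add: rank_dim_range)
qed

lemma rank_scaleR_le: "rank (c *\<^sub>R A) \<le> rank (A :: real^'n^'m)"
proof -
  have *: "c *\<^sub>R A = (c *\<^sub>R Finite_Cartesian_Product.mat 1) ** A"
    by (simp add: Finite_Cartesian_Product.vec_eq_iff matrix_matrix_mult_def
        Finite_Cartesian_Product.mat_def if_distrib[where f = "\<lambda>t. c * t * _"] cong: if_cong)
  show ?thesis by (subst *) (rule rank_mul_le_right)
qed

lemma rank_gram:
  fixes U :: "real^'r^'n"
  shows "rank (U ** transp U) \<le> CARD('r)"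
  using rank_mul_le_left[of U "transp U"] rank_bound[of U] by simp

lemma sum_lessThan_extend:
  fixes f :: "nat \<Rightarrow> 'a::comm_monoid_add"
  assumes "d \<le> r"
  shows "(\<Sum>k<r. if k < d then f k else 0) = (\<Sum>k<d. f k)"
proof -
  have "{k \<in> {..<r}. k < d} = {..<d}" using assms by auto
  then show ?thesis using sum.inter_filter[of "{..<r}" f "\<lambda>k. k < d"] by simp
qed

lemma psd_factorization:
  fixes M :: "real^'n^'n"
  assumes M: "positive_semidefinite M" and r: "rank M \<le> r"
  obtains z where "M = (\<Sum>k<r. outer (z k) (z k))"
proof -
  have sym: "symmetric_matrix M" using M by (simp add: positive_semidefinite_def)
  obtain b \<nu> where b: "orthonormal_on {..<rank M} b"
    "span (b ` {..<rank M}) = range ((*v) M)"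
    "\<forall>i<rank M. M *v b i = \<nu> i *\<^sub>R b i"
    "M = (\<Sum>i<rank M. \<nu> i *\<^sub>R outer (b i) (b i))"
    using spectral_decomposition[OF sym] by (elim exE conjE) (rule that)
  have \<nu>: "0 \<le> \<nu> i" if "i < rank M" for i
  proof -
    have "0 \<le> inner (b i) (M *v b i)" using M by (simp add: positive_semidefinite_def)
    then show ?thesis using that orthonormal_onD[OF b(1)] by (simp add: b(3))
  qed
  \<comment> \<open>Zero vectors beyond the rank pad the family to exactly r members.\<close>
  define z where "z k = (if k < rank M then sqrt (\<nu> k) *\<^sub>R b k else 0)" for k
  have "(\<Sum>k<r. outer (z k) (z k)) = (\<Sum>k<r. if k < rank M then \<nu> k *\<^sub>R outer (b k) (b k) else 0)"
    by (intro sum.cong) (auto simp: z_def outer_simps \<nu>)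
  also have "\<dots> = (\<Sum>k<rank M. \<nu> k *\<^sub>R outer (b k) (b k))" by (rule sum_lessThan_extend[OF r])
  also have "\<dots> = M" by (rule b(4)[symmetric])
  finally show thesis by (rule that[OF HOL.sym])
qed

text \<open>A basis of Z is extended to one of P and cut down to m members that still contain it.
  This pads the new directions of the frame to their prescribed number.\<close>

lemma intermediate_subspace:
  fixes Z P :: "'a::euclidean_space set"
  assumes "subspace Z" "subspace P" "Z \<subseteq> P" "dim Z \<le> m" "m \<le> dim P"
  obtains S where "subspace S" "Z \<subseteq> S" "S \<subseteq> P" "dim S = m"
proof -
  obtain B where B: "B \<subseteq> Z" "independent B" "span B = Z" "card B = dim Z"
    using basis_subspace_exists[OF assms(1)] by metis
  obtain C where C: "B \<subseteq> C" "C \<subseteq> P" "independent C" "P \<subseteq> span C"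
    using maximal_independent_subset_extend[of B P] B assms(3) by blast
  have fin: "finite C" using C(3) by (simp add: independent_imp_finite)
  have "card C = dim P" using C by (simp add: basis_card_eq_dim)
  then obtain D where D: "B \<subseteq> D" "D \<subseteq> C" "card D = m"
    using exists_subset_between[of B m C] B C fin assms(4,5) by auto
  have "independent D" using independent_mono[OF C(3) D(2)] .
  then have "dim (span D) = m" using indep_card_eq_dim_span[of D] D(3) by simp
  moreover have "Z \<subseteq> span D" using span_mono[OF D(1)] B(3) by simp
  moreover have "span D \<subseteq> P" using D C assms(2) by (intro span_minimal) auto
  ultimately show thesis using that subspace_span by blast
qed

lemma outer_in_span:
  assumes "x \<in> span (q ` I)" "y \<in> span (q ` I)"
  shows "outer x y \<in> span ((\<lambda>(i, j). outer (q i) (q j)) ` (I \<times> I))" (is "_ \<in> span ?B")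
proof -
  have "outer (q i) y \<in> span ?B" if "i \<in> I" for i
  proof -
    have "subspace {y. outer (q i) y \<in> span ?B}"
      by (auto simp: subspace_def outer_simps intro: span_add span_scale span_zero)
    moreover have "q ` I \<subseteq> {y. outer (q i) y \<in> span ?B}"
      using that by (auto intro!: span_base)
    ultimately show ?thesis using span_minimal assms(2) by blast
  qed
  then have "q ` I \<subseteq> {x. outer x y \<in> span ?B}" by blast
  moreover have "subspace {x. outer x y \<in> span ?B}"
    by (auto simp: subspace_def outer_simps intro: span_add span_scale span_zero)
  ultimately show ?thesis using span_minimal assms(1) by blast
qed

text \<open>Every member of the span maps into the span of the q_i. This is what lets the restricted
  isometry property act on a whole linear space.\<close>

lemma rank_le_span_outer:
  fixes q :: "nat \<Rightarrow> real^'n"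
  assumes "X \<in> span ((\<lambda>(i, j). outer (q i) (q j)) ` ({..<l} \<times> {..<l}))"
  shows "rank X \<le> l"
proof -
  let ?T = "{X :: real^'n^'n. \<forall>v. X *v v \<in> span (q ` {..<l})}"
  have "subspace ?T"
    by (auto simp: subspace_def matrix_vector_mult_add_rdistrib scaleR_matrix_vector_assoc[symmetric]
        intro: span_add span_scale span_zero)
  moreover have "(\<lambda>(i, j). outer (q i) (q j)) ` ({..<l} \<times> {..<l}) \<subseteq> ?T"
    by (clarsimp simp: outer_mult_vec) (intro span_scale span_base imageI, simp)
  ultimately have "range ((*v) X) \<subseteq> span (q ` {..<l})"
    using span_minimal assms by blast
  then have "rank X \<le> card (q ` {..<l})"
    unfolding rank_dim_range by (rule dim_le_card) simp
  also have "\<dots> \<le> l" using card_image_le[of "{..<l}" q] by simp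
  finally show ?thesis .
qed

text \<open>Every point of the line through M and N is a combination of two matrices of rank at most
  r, so both it and the direction N - M are within reach of the restricted isometry
  property.\<close>

lemma RIP_expansion:
  fixes f :: "real^'n^'n \<Rightarrow> real"
  assumes f: "twice_continuously_differentiable f" and rip: "RIP \<delta> (2 * r) (2 * r) f"
    and rank: "rank M \<le> r" "rank N \<le> r"
  shows "f M + inner (grad f M) (N - M) + (1 - \<delta>) / 2 * (norm (N - M))\<^sup>2 \<le> f N"
proof -
  obtain t where t: "f (M + (N - M)) = f M + inner (grad f M) (N - M)
      + hessian f (M + t *\<^sub>R (N - M)) (N - M) (N - M) / 2"
    using taylor_hessian[OF f] by blast
  have "rank (N - M) \<le> 2 * r"
    using rank_add_le[of N "(-1) *\<^sub>R M"] rank_scaleR_le[of "-1" M] rank by simp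
  moreover have "M + t *\<^sub>R (N - M) = (1 - t) *\<^sub>R M + t *\<^sub>R N" by (simp add: algebra_simps)
  then have "rank (M + t *\<^sub>R (N - M)) \<le> 2 * r"
    using rank_add_le[of "(1 - t) *\<^sub>R M" "t *\<^sub>R N"] rank_scaleR_le[of "1 - t" M] rank_scaleR_le[of t N] rank
    by simp
  ultimately have "(1 - \<delta>) * (norm (N - M))\<^sup>2 \<le> hessian f (M + t *\<^sub>R (N - M)) (N - M) (N - M)"
    using rip by (simp add: RIP_def)
  then show ?thesis using t by simp
qed

lemma necessity:
  fixes f :: "real^'n^'n \<Rightarrow> real" and U :: "real^'r^'n"
  assumes card: "CARD('r) \<le> CARD('n)" and l: "l = min CARD('n) (2 * CARD('r))"
    and \<delta>: "0 \<le> \<delta>" "\<delta> < 1"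
    and adm: "admissible_objective CARD('r) f"
    and rip: "RIP \<delta> (2 * CARD('r)) (2 * CARD('r)) f"
    and spur: "spurious_second_order_critical (factored f) U"
  shows "\<exists>\<alpha> S L A C. conditions CARD('r) l \<delta> \<alpha> S L A C"
proof -
  define r where "r = CARD('r)"
  define m where "m = l - r"
  have rpos: "0 < r" by (simp add: r_def)
  have lrm: "l = r + m" using l card by (simp add: m_def r_def)
  have tcd: "twice_continuously_differentiable f"
    and gsym: "\<And>M. symmetric_matrix M \<Longrightarrow> symmetric_matrix (grad f M)"
    using adm by (auto simp: admissible_objective_def)
  obtain Ms where Ms: "grad f Ms = 0" "positive_semidefinite Ms" "rank Ms \<le> r"
    using adm by (auto simp: admissible_objective_def first_order_critical_def r_def)
  have rip': "RIP \<delta> (2 * r) (2 * r) f" using rip by (simp add: r_def)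
  note expand = RIP_expansion[OF tcd rip']
  define M where "M = U ** transp U"
  define G0 where "G0 = grad f M"
  have symM: "symmetric_matrix M" unfolding M_def by (rule symmetric_matrix_gram)
  have symG: "symmetric_matrix G0" unfolding G0_def by (rule gsym[OF symM])
  have rankM: "rank M \<le> r" unfolding M_def r_def by (rule rank_gram)
  have "2 *\<^sub>R (G0 ** U) = 0"
    using spur grad_factored[OF tcd gsym, of U]
    by (simp add: spurious_second_order_critical_def second_order_critical_def G0_def M_def)
  then have GU: "G0 ** U = 0" by simp
  have second: "0 \<le> 2 * inner G0 (V ** transp V)
      + hessian f M (U ** transp V + V ** transp U) (U ** transp V + V ** transp U)" for V
  proof -
    have "0 \<le> hessian (factored f) U V V"
      using spur by (simp add: spurious_second_order_critical_def second_order_critical_def)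
    then show ?thesis using hessian_factored[OF tcd gsym, of U V]
      unfolding G0_def M_def by linarith
  qed
  \<comment> \<open>A critical point of rank at most r minimizes f among all matrices of rank at
    most r, so a spurious U cannot be a factor of it.\<close>
  have "M \<noteq> Ms"
  proof
    assume "M = Ms"
    have "f Ms \<le> f (V ** transp V)" for V :: "real^'r^'n"
    proof -
      have "rank (V ** transp V) \<le> r" unfolding r_def by (rule rank_gram)
      from expand[OF Ms(3) this] Ms(1) \<delta>
      have "f Ms + (1 - \<delta>) / 2 * (norm (V ** transp V - Ms))\<^sup>2 \<le> f (V ** transp V)" by simp
      moreover have "0 \<le> (1 - \<delta>) / 2 * (norm (V ** transp V - Ms))\<^sup>2" using \<delta> by simp
      ultimately show ?thesis by linarith
    qed
    then have "global_minimizer (factored f) U"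
      using \<open>M = Ms\<close> by (simp add: global_minimizer_def factored_def M_def)
    then show False using spur by (simp add: spurious_second_order_critical_def)
  qed
  have inner_G0_M: "inner G0 M = 0"
    using inner_matrix_mult_left[of G0 U U] GU by (simp add: M_def)
  \<comment> \<open>Adding the expansions at M and at \<open>Ms\<close> cancels the function values,
    and the leftover square is strictly positive.\<close>
  have inner_G0_Ms: "inner G0 Ms < 0"
  proof -
    have "f M + inner G0 (Ms - M) + (1 - \<delta>) / 2 * (norm (Ms - M))\<^sup>2 \<le> f Ms"
      "f Ms + (1 - \<delta>) / 2 * (norm (M - Ms))\<^sup>2 \<le> f M"
      using expand[OF rankM Ms(3)] expand[OF Ms(3) rankM] Ms(1) by (simp_all add: G0_def)
    moreover have "0 < (1 - \<delta>) / 2 * (norm (M - Ms))\<^sup>2" using \<open>M \<noteq> Ms\<close> \<delta> by simp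
    ultimately show ?thesis
      using inner_G0_M by (simp add: inner_diff_right norm_minus_commute)
  qed
  obtain z where z: "Ms = (\<Sum>k<r. outer (z k) (z k))"
    using psd_factorization[OF Ms(2,3)] by blast
  \<comment> \<open>If \<open>U v = 0\<close> with \<open>v \<noteq> 0\<close>, the variations \<open>w v\<^sup>T\<close> make \<open>G0\<close> positive semidefinite.\<close>
  have "rank U = r"
  proof (rule ccontr)
    assume "rank U \<noteq> r"
    then obtain v where v: "v \<noteq> 0" "U *v v = 0"
      using matrix_nonfull_linear_equations_eq[of U] by (auto simp: r_def)
    have "0 \<le> inner w (G0 *v w)" for w
    proof -
      have 1: "U ** transp (outer w v) = 0"
        unfolding transp_outer matrix_mult_outer v(2) by (rule bilinear_lzero[OF bilinear_outer])
      then have "outer w v ** transp U = 0"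
        by (metis Finite_Cartesian_Product.matrix_transpose_mul transp_outer
            Finite_Cartesian_Product.transpose_transpose linear_0 linear_transp)
      moreover have "hessian f M 0 0 = 0" by (simp add: hessian_def)
      moreover have "outer w v ** transp (outer w v) = inner v v *\<^sub>R outer w w"
        by (simp add: transp_outer matrix_mult_outer outer_mult_vec outer_simps)
      ultimately have "0 \<le> inner v v * inner w (G0 *v w)"
        using second[of "outer w v"] 1 by (simp add: inner_matrix_outer)
      moreover have "0 < inner v v" using v(1) by simp
      ultimately show ?thesis by (simp add: zero_le_mult_iff)
    qed
    then have "0 \<le> inner G0 Ms"
      unfolding z inner_sum_right inner_matrix_outer by (intro sum_nonneg)
    then show False using inner_G0_Ms by simp
  qed
  \<comment> \<open>U^T M U = (U^T U)^2 is injective because U is, and its rank is at most that of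
    M.\<close>
  have rankM_eq: "rank M = r"
  proof -
    have "inj ((*v) U)" using \<open>rank U = r\<close> by (simp add: full_rank_injective[symmetric] r_def)
    have "inj ((*v) (transp U ** U))"
    proof (rule injI)
      fix x y assume "(transp U ** U) *v x = (transp U ** U) *v y"
      then have "(transp U ** U) *v (x - y) = 0" by (simp add: matrix_vector_mult_diff_distrib)
      then have "inner (x - y) (transp U *v (U *v (x - y))) = 0"
        by (simp add: matrix_vector_mul_assoc)
      then have "inner (U *v (x - y)) (U *v (x - y)) = 0"
        by (metis dot_lmul_matrix Finite_Cartesian_Product.transpose_transpose transpose_matrix_vector)
      then have "U *v x = U *v y" by (simp add: matrix_vector_mult_diff_distrib)
      then show "x = y" using \<open>inj ((*v) U)\<close> by (simp add: injD)
    qed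
    then have "inj ((*v) (transp U ** U) \<circ> (*v) (transp U ** U))" by (intro inj_compose)
    then have "inj ((*v) ((transp U ** U) ** (transp U ** U)))"
      by (simp add: o_def matrix_vector_mul_assoc)
    then have "rank ((transp U ** U) ** (transp U ** U)) = r"
      by (simp add: full_rank_injective[symmetric] r_def)
    moreover have "(transp U ** U) ** (transp U ** U) = transp U ** (M ** U)"
      by (simp add: M_def matrix_mul_assoc)
    ultimately have "r \<le> rank M"
      using rank_mul_le_right[of "transp U" "M ** U"] rank_mul_le_left[of M U] by simp
    then show ?thesis using rankM by simp
  qed
  obtain b \<sigma> where b: "orthonormal_on {..<r} b" "span (b ` {..<r}) = range ((*v) M)"
    "\<forall>i<r. M *v b i = \<sigma> i *\<^sub>R b i" "M = (\<Sum>i<r. \<sigma> i *\<^sub>R outer (b i) (b i))"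
    using spectral_decomposition[OF symM, unfolded rankM_eq] by (elim exE conjE) (rule that)
  have \<sigma>: "0 < \<sigma> i" and Ub: "(norm (transp U *v b i))\<^sup>2 = \<sigma> i" if "i < r" for i
  proof -
    have bb: "inner (b i) (b i) = 1" using orthonormal_onD[OF b(1)] that by simp
    have "\<sigma> i = inner (b i) (M *v b i)" by (simp add: b(3)[rule_format, OF that] bb)
    also have "\<dots> = inner (transp U *v b i) (transp U *v b i)"
      unfolding M_def matrix_vector_mul_assoc[symmetric]
      by (metis dot_lmul_matrix transpose_matrix_vector)
    finally show "(norm (transp U *v b i))\<^sup>2 = \<sigma> i" by (simp add: power2_norm_eq_inner)
    then have "0 \<le> \<sigma> i" by (metis zero_le_power2)
    moreover have "\<sigma> i \<noteq> 0"
    proof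
      assume "\<sigma> i = 0"
      have "b i \<in> range ((*v) M)" unfolding b(2)[symmetric] using that by (intro span_base) simp
      then obtain x where "b i = M *v x" by blast
      then have "inner (b i) (b i) = inner (M *v b i) x"
        by (simp add: symmetric_matrix_inner[OF symM])
      then show False using b(3)[rule_format, OF that] \<open>\<sigma> i = 0\<close> bb by simp
    qed
    ultimately show "0 < \<sigma> i" by simp
  qed
  have Gb: "G0 *v b i = 0" if "i < r" for i
  proof -
    have "\<sigma> i *\<^sub>R (G0 *v b i) = G0 *v (M *v b i)" by (simp add: b(3)[rule_format, OF that] matrix_vector_mult_scaleR)
    also have "\<dots> = ((G0 ** U) ** transp U) *v b i"
      by (simp add: M_def matrix_vector_mul_assoc matrix_mul_assoc)
    finally show ?thesis using GU \<sigma>[OF that] by simp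
  qed
  \<comment> \<open>T is the range of M, P its orthogonal complement, and Z the span of the
    projections of the z_k to P. Its dimension is at most r and at most n - r, and m is the smaller
    of the two; hence Z can be enlarged inside P to dimension exactly m.\<close>
  define T where "T = span (b ` {..<r})"
  define P where "P = {y :: real^'n. \<forall>x\<in>T. inner x y = 0}"
  define Z where "Z = span ((\<lambda>k. z k - (\<Sum>i<r. inner (b i) (z k) *\<^sub>R b i)) ` {..<r})"
  have P_iff: "y \<in> P \<longleftrightarrow> (\<forall>i<r. inner (b i) y = 0)" for y
  proof
    assume "\<forall>i<r. inner (b i) y = 0"
    then have "b ` {..<r} \<subseteq> {x. inner x y = 0}" by auto
    moreover have "subspace {x. inner x y = 0}" by (auto simp: subspace_def inner_add_left)
    ultimately have "T \<subseteq> {x. inner x y = 0}" unfolding T_def by (rule span_minimal)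
    then show "y \<in> P" by (auto simp: P_def)
  qed (auto simp: P_def T_def intro: span_base)
  have subP: "subspace P" by (auto simp: P_def subspace_def inner_add_right)
  have "dim P + dim T = CARD('n)"
    using dim_subspace_orthogonal_to_vectors[of T UNIV]
    by (simp add: P_def T_def Linear_Algebra.orthogonal_def)
  then have dimP: "dim P = CARD('n) - r"
    unfolding T_def dim_orthonormal[OF b(1)] by simp
  have "Z \<subseteq> P" unfolding Z_def
  proof (intro span_minimal subP, clarify)
    fix k assume "k < r"
    have "inner (b i) (\<Sum>j<r. inner (b j) (z k) *\<^sub>R b j) = inner (b i) (z k)" if "i < r" for i
    proof -
      have "inner (b i) (\<Sum>j<r. inner (b j) (z k) *\<^sub>R b j) = (\<Sum>j<r. if j = i then inner (b i) (z k) else 0)"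
        unfolding inner_sum_right using orthonormal_onD[OF b(1)] that by (intro sum.cong) auto
      then show ?thesis using that by simp
    qed
    then show "z k - (\<Sum>i<r. inner (b i) (z k) *\<^sub>R b i) \<in> P"
      by (simp add: P_iff inner_diff_right)
  qed
  have "dim Z \<le> r"
    unfolding Z_def dim_span
    using dim_le_card'[of "(\<lambda>k. z k - (\<Sum>i<r. inner (b i) (z k) *\<^sub>R b i)) ` {..<r}"]
      card_image_le[of "{..<r}" "\<lambda>k. z k - (\<Sum>i<r. inner (b i) (z k) *\<^sub>R b i)"] by simp
  then have "dim Z \<le> m"
    using dim_subset[OF \<open>Z \<subseteq> P\<close>] dimP l by (simp add: m_def r_def)
  moreover have "m \<le> dim P" using dimP l by (simp add: m_def)
  ultimately obtain S where S: "subspace S" "Z \<subseteq> S" "S \<subseteq> P" "dim S = m"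
    using intermediate_subspace[OF _ subP \<open>Z \<subseteq> P\<close>] by (auto simp: Z_def)
  have linG: "linear ((*v) G0)" by simp
  \<comment> \<open>S need not be invariant under \<open>G0\<close>; vanishing off-diagonal entries
    within S are all that the compressed gradient needs.\<close>
  obtain c where c: "orthonormal_on {..<m} c" "span (c ` {..<m}) = S"
    "\<And>i j. i < m \<Longrightarrow> j < m \<Longrightarrow> i \<noteq> j \<Longrightarrow> inner (G0 *v c i) (c j) = 0"
    using diagonalize_on_subspace[OF linG symmetric_matrix_inner[OF symG] S(1)] unfolding S(4) by blast
  define q where "q i = (if i < r then b i else c (i - r))" for i
  define \<mu> where "\<mu> j = - inner (G0 *v c j) (c j)" for j
  have bc: "inner (b i) (c j) = 0" if "i < r" "j < m" for i j
  proof -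
    have "c j \<in> S" unfolding c(2)[symmetric] using that by (intro span_base) simp
    then show ?thesis using S(3) P_iff that by blast
  qed
  have q: "orthonormal_on {..<r + m} q"
    using orthonormal_onD[OF b(1)] orthonormal_onD[OF c(1)] bc
    by (auto simp: orthonormal_on_def q_def inner_commute)
  have q_im: "b ` {..<r} \<subseteq> q ` {..<r + m}" "c ` {..<m} \<subseteq> q ` {..<r + m}"
  proof -
    show "b ` {..<r} \<subseteq> q ` {..<r + m}" by (auto simp: q_def image_iff)
    have "c j = q (r + j)" for j by (simp add: q_def)
    then show "c ` {..<m} \<subseteq> q ` {..<r + m}" by auto
  qed
  have zq: "z k \<in> span (q ` {..<r + m})" if "k < r" for k
  proof -
    have "z k - (\<Sum>i<r. inner (b i) (z k) *\<^sub>R b i) \<in> S"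
      using S(2) that by (auto simp: Z_def intro: span_base)
    then have "z k - (\<Sum>i<r. inner (b i) (z k) *\<^sub>R b i) \<in> span (q ` {..<r + m})"
      using span_mono[OF q_im(2)] c(2) by blast
    moreover have "(\<Sum>i<r. inner (b i) (z k) *\<^sub>R b i) \<in> span (q ` {..<r + m})"
      using q_im(1) by (intro span_sum span_scale span_base) auto
    ultimately have "(z k - (\<Sum>i<r. inner (b i) (z k) *\<^sub>R b i)) + (\<Sum>i<r. inner (b i) (z k) *\<^sub>R b i)
        \<in> span (q ` {..<r + m})" by (rule span_add)
    then show ?thesis by simp
  qed
  define K where "K = frame_difference r \<sigma> q z"
  define G where "G = frame_gradient r m \<mu> q"
  have K: "K = M - Ms" by (simp add: K_def frame_difference_def b(4) z q_def)
  define \<S> where "\<S> = span ((\<lambda>(i, j). outer (q i) (q j)) ` ({..<r + m} \<times> {..<r + m}))"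
  have q_span: "q i \<in> span (q ` {..<r + m})" if "i < r + m" for i
    using that by (intro span_base) simp
  have M\<S>: "M \<in> \<S>"
  proof -
    have "M = (\<Sum>i<r. \<sigma> i *\<^sub>R outer (q i) (q i))" by (simp add: b(4) q_def)
    also have "\<dots> \<in> \<S>" unfolding \<S>_def
      by (intro span_sum span_scale outer_in_span) (simp_all add: q_span)
    finally show ?thesis .
  qed
  have Ms\<S>: "Ms \<in> \<S>" unfolding z \<S>_def
    by (intro span_sum outer_in_span) (simp_all add: zq)
  have G\<S>: "G \<in> \<S>" unfolding G_def frame_gradient_def \<S>_def
    by (intro span_neg span_sum span_scale outer_in_span) (simp_all add: q_span)
  \<comment> \<open>It suffices to test the products of frame vectors. If either index is below r,
    both sides vanish because \<open>G0\<close> annihilates the b_i; otherwise the choice of c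
    applies.\<close>
  have G_inner: "inner G X = inner (grad f M - grad f Ms) X" if "X \<in> \<S>" for X
  proof -
    have gen: "inner G (outer (q i) (q j)) = inner G0 (outer (q i) (q j))" if ij: "i < r + m" "j < r + m" for i j
    proof -
      note Gq = frame_gradient_mult_vec[of r m \<mu> q "q j", folded G_def]
      show ?thesis
      proof (cases "j < r")
        case True
        then have "G *v q j = 0" unfolding Gq using orthonormal_onD[OF q] by simp
        moreover have "G0 *v q j = 0" using Gb True by (simp add: q_def)
        ultimately show ?thesis by (simp add: inner_matrix_outer)
      next
        case False
        then obtain j' where j': "j = r + j'" "j' < m" using ij(2) by (metis add_less_cancel_left le_Suc_ex not_less)
        have "(\<Sum>k<m. (\<mu> k * inner (q (r + k)) (q j)) *\<^sub>R q (r + k)) = (\<Sum>k<m. if k = j' then \<mu> j' *\<^sub>R q j else 0)"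
          using orthonormal_onD[OF q] j' by (intro sum.cong) auto
        then have "G *v q j = - (\<mu> j' *\<^sub>R q j)" unfolding Gq using j'(2) by simp
        moreover have "inner (q i) (G0 *v q j) = - \<mu> j' * inner (q i) (q j)"
        proof (cases "i < r")
          case True
          then have "inner (q i) (G0 *v q j) = 0"
            using Gb by (simp add: q_def flip: symmetric_matrix_inner[OF symG])
          then show ?thesis using orthonormal_onD[OF q ] ij True False by auto
        next
          case False
          then obtain i' where i': "i = r + i'" "i' < m" using ij(1) by (metis add_less_cancel_left le_Suc_ex not_less)
          show ?thesis
          proof (cases "i' = j'")
            case True
            then show ?thesis
              using i' j' orthonormal_onD[OF c(1)] by (simp add: q_def \<mu>_def inner_commute)
          next
            case False
            then show ?thesis
              using i' j' orthonormal_onD[OF c(1)] c(3)[of j' i'] by (simp add: q_def inner_commute)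
          qed
        qed
        ultimately show ?thesis by (simp add: inner_matrix_outer)
      qed
    qed
    have "subspace {X. inner G X = inner G0 X}" by (auto simp: subspace_def inner_add_right)
    moreover have "(\<lambda>(i, j). outer (q i) (q j)) ` ({..<r + m} \<times> {..<r + m}) \<subseteq> {X. inner G X = inner G0 X}"
      using gen by auto
    ultimately have "\<S> \<subseteq> {X. inner G X = inner G0 X}" unfolding \<S>_def by (intro span_minimal)
    then show ?thesis using that Ms(1) by (auto simp: G0_def)
  qed
  have "r + m \<le> 2 * r" using l lrm by (simp add: r_def)
  then have rank\<S>: "rank X \<le> 2 * r" if "X \<in> \<S>" for X
    using rank_le_span_outer[OF that[unfolded \<S>_def]] by simp
  have coco: "(1 - \<delta>\<^sup>2) * (norm K)\<^sup>2 + (norm G)\<^sup>2 \<le> 2 * inner G K"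
    unfolding K
  proof (rule cocoercive_on_subspace[OF tcd _ Ms\<S> M\<S> G\<S> G_inner _ \<delta>(1)])
    show "subspace \<S>" by (simp add: \<S>_def)
    fix z u assume "z \<in> \<S>" "u \<in> \<S>"
    then show "(1 - \<delta>) * (norm u)\<^sup>2 \<le> hessian f z u u \<and> hessian f z u u \<le> (1 + \<delta>) * (norm u)\<^sup>2"
      using rip' rank\<S> unfolding RIP_def by blast
  qed
  have ord: "\<mu> j \<le> (1 + \<delta>) * \<sigma> i" if "i < r" "j < m" for i j
  proof -
    \<comment> \<open>With this v, U v = \<sigma>_i b_i and |v|^2 = \<sigma>_i. The variation c_j
      v^T therefore yields V V^T = \<sigma>_i c_j c_j^T and |X|^2 = 2 \<sigma>_i^2, and dividing the
      second-order condition by 2 \<sigma>_i gives the claim.\<close>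
    define v where "v = transp U *v b i"
    define V where "V = outer (c j) v"
    define X where "X = U ** transp V + V ** transp U"
    have "U *v v = M *v b i" by (simp only: v_def M_def matrix_vector_mul_assoc)
    then have Uv: "U *v v = \<sigma> i *\<^sub>R b i" using b(3) that(1) by simp
    have UV: "U ** transp V = \<sigma> i *\<^sub>R outer (b i) (c j)"
      by (simp add: V_def transp_outer matrix_mult_outer Uv outer_simps)
    have VU: "V ** transp U = \<sigma> i *\<^sub>R outer (c j) (b i)"
    proof -
      have "V ** transp U = transp (U ** transp V)"
        by (simp add: Finite_Cartesian_Product.matrix_transpose_mul)
      then show ?thesis by (simp add: UV transp_scaleR transp_outer)
    qed
    have VV: "V ** transp V = \<sigma> i *\<^sub>R outer (c j) (c j)"
      using Ub[OF that(1)] by (simp add: V_def transp_outer matrix_mult_outer outer_mult_vec outer_simps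
          v_def power2_norm_eq_inner)
    have "(norm X)\<^sup>2 = 2 * (\<sigma> i)\<^sup>2"
      using bc[OF that] orthonormal_onD[OF b(1)] orthonormal_onD[OF c(1)] that
      unfolding power2_norm_eq_inner
      by (simp add: X_def UV VU inner_add_left inner_add_right inner_outer inner_commute power2_eq_square)
    moreover have "hessian f M X X \<le> (1 + \<delta>) * (norm X)\<^sup>2"
    proof -
      have "rank (U ** transp V) \<le> r" "rank (V ** transp U) \<le> r"
        using rank_mul_le_left[of U "transp V"] rank_mul_le_left[of V "transp U"]
          rank_bound[of U] rank_bound[of V] by (simp_all add: r_def)
      then have "rank X \<le> 2 * r" using rank_add_le[of "U ** transp V" "V ** transp U"] by (simp add: X_def)
      then show ?thesis using rip' rankM by (simp add: RIP_def)
    qed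
    moreover have "inner G0 (V ** transp V) = - (\<sigma> i * \<mu> j)"
      by (simp add: VV inner_matrix_outer \<mu>_def inner_commute)
    ultimately have "\<sigma> i * \<mu> j \<le> \<sigma> i * ((1 + \<delta>) * \<sigma> i)"
      using second[of V] unfolding X_def[symmetric] by (simp add: power2_eq_square algebra_simps)
    then show ?thesis using \<sigma>[OF that(1)] by simp
  qed
  obtain idx :: "'r \<Rightarrow> nat" where idx: "bij_betw idx UNIV {..<r}"
    using ex_bij_betw_finite_nat[of "UNIV :: 'r set"] by (auto simp: r_def lessThan_atLeast0)
  have "K \<noteq> 0" using \<open>M \<noteq> Ms\<close> by (simp add: K)
  then show ?thesis
    unfolding lrm r_def[symmetric] using coco unfolding K_def G_def
    by (intro conditions_of_frame[OF idx rpos \<delta> q, where z = z and \<sigma> = \<sigma> and \<mu> = \<mu>] zq \<sigma> ord)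
qed

subsection \<open>Sufficiency\<close>

lemma
  fixes H :: "'a::euclidean_space \<Rightarrow> 'a" and a :: 'a
  assumes H: "linear H" "\<And>x y. inner (H x) y = inner x (H y)"
  defines "f \<equiv> \<lambda>x. inner (H (x - a)) (x - a) / 2"
  shows grad_quadratic: "grad f x = H (x - a)"
    and hessian_quadratic: "hessian f x u v = inner (H u) v"
    and twice_continuously_differentiable_quadratic: "twice_continuously_differentiable f"
proof -
  have H': "((\<lambda>x. H (x - a)) has_derivative H) (at x)" for x
  proof -
    have "((\<lambda>x. x - a) has_derivative (\<lambda>x. x)) (at x)" by (auto intro!: derivative_eq_intros)
    from has_derivative_compose[OF this linear_imp_has_derivative[OF H(1)]] show ?thesis .
  qed
  have G: "GDERIV f x :> H (x - a)" for x
  proof -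
    have "((\<lambda>x. x - a) has_derivative (\<lambda>x. x)) (at x)" by (auto intro!: derivative_eq_intros)
    from has_derivative_inner[OF H' this]
    have "((\<lambda>x. inner (H (x - a)) (x - a)) has_derivative
        (\<lambda>h. inner (H (x - a)) h + inner (H h) (x - a))) (at x)" .
    then have "((\<lambda>x. (1 / 2) *\<^sub>R inner (H (x - a)) (x - a)) has_derivative
        (\<lambda>h. (1 / 2) *\<^sub>R (inner (H (x - a)) h + inner (H h) (x - a)))) (at x)"
      by (rule has_derivative_scaleR_right)
    moreover have "(\<lambda>h. (1 / 2) *\<^sub>R (inner (H (x - a)) h + inner (H h) (x - a))) = (\<lambda>h. inner h (H (x - a)))"
    proof
      fix h
      show "(1 / 2) *\<^sub>R (inner (H (x - a)) h + inner (H h) (x - a)) = inner h (H (x - a))"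
        unfolding H(2)[of h "x - a"] inner_commute[of "H (x - a)" h] by simp
    qed
    ultimately show ?thesis by (simp add: gderiv_def f_def)
  qed
  have grad: "grad f = (\<lambda>x. H (x - a))" using grad_eqI[OF G] by auto
  then show "grad f x = H (x - a)" by simp
  have fd: "frechet_derivative (grad f) (at x) = H" for x
    unfolding grad by (rule frechet_derivative_at[OF H', symmetric])
  then show "hessian f x u v = inner (H u) v" by (simp add: hessian_def)
  have "f differentiable (at x)" for x using G unfolding gderiv_def differentiable_def by blast
  moreover have "grad f differentiable (at x)" for x
    unfolding grad differentiable_def using H' by blast
  ultimately show "twice_continuously_differentiable f"
    by (simp add: twice_continuously_differentiable_def fd)
qed

text \<open>An orthonormal family e serves as column index: the sum of x_k e_k^T is a factor matrix
  of type \<open>real^'r^'n\<close> built from a family indexed by numbers, and e drops out of the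
  products.\<close>

lemma sum_outer_mult_transp:
  fixes e :: "nat \<Rightarrow> real^'r" and x :: "nat \<Rightarrow> real^'n" and y :: "nat \<Rightarrow> real^'m"
  assumes e: "orthonormal_on {..<r} e"
  shows "(\<Sum>k<r. outer (x k) (e k)) ** transp (\<Sum>k<r. outer (y k) (e k)) = (\<Sum>k<r. outer (x k) (y k))"
proof -
  have "inner (e k) (\<Sum>j<r. c j *\<^sub>R e j) = c k" if "k < r" for k c
  proof -
    have "inner (e k) (\<Sum>j<r. c j *\<^sub>R e j) = (\<Sum>j<r. if j = k then c k else 0)"
      unfolding inner_sum_right using orthonormal_onD[OF e] that by (intro sum.cong) auto
    then show ?thesis using that by simp
  qed
  then show ?thesis
    unfolding matrix_eq matrix_vector_mul_assoc[symmetric] transp_sum transp_outer sum_outer_mult_vec'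
    by simp
qed

text \<open>The identity map on the whole space is diagonalized, which leaves only the orthonormal
  basis.\<close>

lemma orthonormal_basis_nat:
  obtains e :: "nat \<Rightarrow> 'a::euclidean_space"
  where "orthonormal_on {..<DIM('a)} e" "span (e ` {..<DIM('a)}) = UNIV"
proof (rule diagonalize_on_subspace[of "\<lambda>x :: 'a. x" UNIV])
  show "linear (\<lambda>x :: 'a. x)" by (rule linear_id[unfolded id_def])
  fix b :: "nat \<Rightarrow> 'a"
  assume "orthonormal_on {..<dim (UNIV :: 'a set)} b" "span (b ` {..<dim (UNIV :: 'a set)}) = UNIV"
  then show thesis using that by simp
qed simp_all

text \<open>The first-order data \<open>K\<close>, \<open>G\<close> are completed to a quadratic objective whose Hessian \<open>H\<close>
  is \<open>1 + \<delta>\<close> off a single direction \<open>w\<close> and maps \<open>K\<close> to \<open>G\<close>. For \<open>g = 0\<close> the inequality forces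
  \<open>w = 0\<close>, and the quotient by \<open>g\<close> is harmless.\<close>

lemma rank_one_update:
  fixes K G :: "'a::euclidean_space"
  assumes \<delta>: "0 \<le> \<delta>" and GK: "(norm (G - K))\<^sup>2 \<le> \<delta>\<^sup>2 * (norm K)\<^sup>2"
  defines "w \<equiv> (1 + \<delta>) *\<^sub>R K - G"
  defines "H \<equiv> \<lambda>X. (1 + \<delta>) *\<^sub>R X - (inner w X / inner w K) *\<^sub>R w"
  shows "linear H" "inner (H X) Y = inner X (H Y)" "H K = G"
    "(1 - \<delta>) * (norm X)\<^sup>2 \<le> inner (H X) X" "inner (H X) X \<le> (1 + \<delta>) * (norm X)\<^sup>2"
proof -
  define g where "g = inner w K"
  show "linear H"
    by (rule linearI) (simp_all add: H_def inner_add_right algebra_simps add_divide_distrib)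
  show "inner (H X) Y = inner X (H Y)" for X Y
    by (simp add: H_def inner_diff_left inner_diff_right inner_commute)
  \<comment> \<open>Write w = \<delta> K - (G - K) and expand. For g > 0 the bound says that the
    subtracted rank-one form has norm |w|^2 / g <= 2 \<delta>, so it lowers 1 + \<delta> at most to
    1 - \<delta>.\<close>
  have ww: "(norm w)\<^sup>2 \<le> 2 * \<delta> * g"
  proof -
    have "(norm w)\<^sup>2 = \<delta>\<^sup>2 * (norm K)\<^sup>2 - 2 * \<delta> * inner K (G - K) + (norm (G - K))\<^sup>2"
      unfolding w_def power2_norm_eq_inner
      by (simp add: inner_diff_left inner_diff_right inner_commute algebra_simps power2_eq_square)
    also have "\<dots> \<le> 2 * \<delta>\<^sup>2 * (norm K)\<^sup>2 - 2 * \<delta> * inner K (G - K)" using GK by simp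
    also have "\<dots> = 2 * \<delta> * g"
      unfolding w_def g_def power2_norm_eq_inner
      by (simp add: inner_diff_left inner_diff_right inner_commute algebra_simps power2_eq_square)
    finally show ?thesis .
  qed
  have w0: "w = 0" if "g \<le> 0"
  proof -
    have "2 * \<delta> * g \<le> 0" using that \<delta> by (simp add: mult_nonneg_nonpos)
    then have "(norm w)\<^sup>2 \<le> 0" using ww by linarith
    then show ?thesis by simp
  qed
  have HXX: "inner (H X) X = (1 + \<delta>) * (norm X)\<^sup>2 - (inner w X)\<^sup>2 / g"
    unfolding power2_norm_eq_inner H_def g_def by (simp add: inner_diff_left power2_eq_square)
  show "H K = G"
  proof (cases "g \<le> 0")
    case True
    then show ?thesis using w0 by (simp add: H_def) (simp add: w_def)
  next
    case False
    then show ?thesis by (simp add: H_def g_def[symmetric]) (simp add: w_def)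
  qed
  have "0 \<le> (inner w X)\<^sup>2 / g \<and> (inner w X)\<^sup>2 / g \<le> 2 * \<delta> * (norm X)\<^sup>2"
  proof (cases "g \<le> 0")
    case True
    then show ?thesis using w0 \<delta> by simp
  next
    case False
    have "(inner w X)\<^sup>2 \<le> (norm w)\<^sup>2 * (norm X)\<^sup>2"
      using Cauchy_Schwarz_ineq[of w X] by (simp add: power2_norm_eq_inner)
    also have "\<dots> \<le> 2 * \<delta> * g * (norm X)\<^sup>2" using ww by (simp add: mult_right_mono)
    finally show ?thesis using False by (simp add: field_simps)
  qed
  then show "(1 - \<delta>) * (norm X)\<^sup>2 \<le> inner (H X) X" "inner (H X) X \<le> (1 + \<delta>) * (norm X)\<^sup>2"
    unfolding HXX by (auto simp: algebra_simps)
qed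

lemma sufficiency:
  fixes l :: nat
  assumes card: "CARD('r::finite) \<le> CARD('n::finite)" and l: "l = min CARD('n) (2 * CARD('r))"
    and \<delta>: "0 \<le> \<delta>" "\<delta> < 1"
    and cond: "conditions CARD('r) l \<delta> \<alpha> S L A C"
    and AC: "A * C\<^sup>T = 0\<^sub>m CARD('r) (l - CARD('r))"
  shows "\<exists>f :: real^'n^'n \<Rightarrow> real. admissible_objective CARD('r) f \<and>
    RIP \<delta> (2 * CARD('r)) (2 * CARD('r)) f \<and>
    (\<exists>U :: real^'r^'n. spurious_second_order_critical (factored f) U)"
proof -
  define r where "r = CARD('r)"
  define m where "m = l - r"
  have rpos: "0 < r" by (simp add: r_def)
  have lrm: "l = r + m" using l card by (simp add: m_def r_def)
  have car: "S \<in> carrier_mat r r" "L \<in> carrier_mat (l - r) (l - r)" "A \<in> carrier_mat r r"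
    "C \<in> carrier_mat (l - r) r" "diagonal_mat S" "diagonal_mat L"
    using cond by (auto simp: conditions_def r_def)
  define \<sigma> where "\<sigma> i = S $$ (i, i)" for i
  define \<mu> where "\<mu> j = L $$ (j, j)" for j
  define a where "a i k = A $$ (i, k)" for i k
  define c where "c j k = C $$ (j, k)" for j k
  have ac: "(\<Sum>k<r. a i k * c j k) = 0" if "i < r" "j < m" for i j
    using index_mult_transpose[OF car(3,4), of i j] AC that by (simp add: a_def c_def m_def r_def)
  obtain q :: "nat \<Rightarrow> real^'n" where q0: "orthonormal_on {..<CARD('n)} q"
    using orthonormal_basis_nat[where 'a = "real^'n"] by auto
  obtain e :: "nat \<Rightarrow> real^'r" where e: "orthonormal_on {..<r} e" "span (e ` {..<r}) = UNIV"
    using orthonormal_basis_nat[where 'a = "real^'r"] by (auto simp: r_def)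
  have q: "orthonormal_on {..<r + m} q"
    using q0 by (rule orthonormal_on_subset) (use l lrm in auto)
  have q': "orthonormal_on {..<r} q" using q by (rule orthonormal_on_subset) auto
  \<comment> \<open>The coordinates of z_k in the frame are column k of A stacked on C.\<close>
  define z where "z k = (\<Sum>i<r. a i k *\<^sub>R q i) + (\<Sum>j<m. c j k *\<^sub>R q (r + j))" for k
  have qz: "inner (q i) (z k) = a i k" if "i < r" for i k
  proof -
    have "inner (q i) (\<Sum>i<r. a i k *\<^sub>R q i) = (\<Sum>j<r. if j = i then a i k else 0)"
      unfolding inner_sum_right using orthonormal_onD[OF q] that by (intro sum.cong) auto
    moreover have "inner (q i) (\<Sum>j<m. c j k *\<^sub>R q (r + j)) = 0"
      unfolding inner_sum_right using orthonormal_onD[OF q] that by (intro sum.neutral) auto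
    ultimately show ?thesis using that by (simp add: z_def inner_add_right)
  qed
  have qz': "inner (q (r + j)) (z k) = c j k" if "j < m" for j k
  proof -
    have "inner (q (r + j)) (\<Sum>j<m. c j k *\<^sub>R q (r + j)) = (\<Sum>i<m. if i = j then c j k else 0)"
      unfolding inner_sum_right using orthonormal_onD[OF q] that by (intro sum.cong) auto
    moreover have "inner (q (r + j)) (\<Sum>i<r. a i k *\<^sub>R q i) = 0"
      unfolding inner_sum_right using orthonormal_onD[OF q] that by (intro sum.neutral) auto
    ultimately show ?thesis using that by (simp add: z_def inner_add_right)
  qed
  have z_span: "z k \<in> span (q ` {..<r + m})" for k
    unfolding z_def by (intro span_add span_sum span_scale span_base) auto
  define K where "K = frame_difference r \<sigma> q z"
  define G where "G = frame_gradient r m \<mu> q"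
  define N where "N = (norm K)\<^sup>2"
  define p where "p = inner G K"
  have p_eq: "p = (\<Sum>j<m. \<mu> j * (\<Sum>k<r. (c j k)\<^sup>2))"
    unfolding p_def G_def K_def inner_frame_gradient_difference[OF q] by (simp add: qz')
  have N_eq: "N = (\<Sum>i<r. (\<sigma> i)\<^sup>2) - 2 * (\<Sum>i<r. \<sigma> i * (\<Sum>k<r. (a i k)\<^sup>2))
      + (\<Sum>k<r. \<Sum>k'<r. (gram_entry r (l - r) A C k k')\<^sup>2)"
  proof -
    have "inner (z k) (z k') = gram_entry r (l - r) A C k k'" for k k'
      using inner_span_frame[OF q, of z k k', OF z_span z_span]
      by (simp add: gram_entry_def qz qz' a_def[symmetric] c_def[symmetric] m_def[symmetric])
    then show ?thesis
      unfolding N_def K_def norm_frame_difference[OF q'] by (simp add: qz)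
  qed
  have cond': "1 - \<delta> < \<alpha> \<and> \<alpha> \<le> (1 + \<delta>) / 2 \<and>
    (\<forall>i<r. \<forall>j<m. \<mu> j \<le> (1 + \<delta>) * \<sigma> i) \<and> (\<forall>i<r. 0 < \<sigma> i) \<and> p = \<alpha> * N \<and>
    (\<Sum>j<m. (\<mu> j)\<^sup>2) \<le> inverse \<alpha> * (2 * \<alpha> - 1 + \<delta>\<^sup>2) * p \<and> p \<noteq> 0"
    using cond unfolding r_def[symmetric] conditions_iff[OF rpos \<delta>(1) car]
    unfolding p_eq N_eq \<sigma>_def \<mu>_def a_def c_def m_def .
  have C: "1 - \<delta> < \<alpha>" "\<And>i j. i < r \<Longrightarrow> j < m \<Longrightarrow> \<mu> j \<le> (1 + \<delta>) * \<sigma> i"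
    "\<And>i. i < r \<Longrightarrow> 0 < \<sigma> i" "p = \<alpha> * N"
    "(\<Sum>j<m. (\<mu> j)\<^sup>2) \<le> inverse \<alpha> * (2 * \<alpha> - 1 + \<delta>\<^sup>2) * p" "p \<noteq> 0"
    using cond' by blast+
  have "\<alpha> > 0" using C(1) \<delta> by simp
  have "0 \<le> N" by (simp add: N_def)
  then have "0 \<le> p" using C(4) \<open>\<alpha> > 0\<close> by simp
  then have "p > 0" using C(6) by simp
  have "inverse \<alpha> * (2 * \<alpha> - 1 + \<delta>\<^sup>2) * p = (2 * \<alpha> - 1 + \<delta>\<^sup>2) * N"
    using C(4) \<open>\<alpha> > 0\<close> by simp
  then have "(norm G)\<^sup>2 \<le> (2 * \<alpha> - 1 + \<delta>\<^sup>2) * N"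
    using C(5) unfolding G_def norm_frame_gradient[OF q] by linarith
  moreover have "(norm (G - K))\<^sup>2 = (norm G)\<^sup>2 - 2 * p + N"
    unfolding p_def N_def power2_norm_eq_inner
    by (simp add: inner_diff_left inner_diff_right inner_commute)
  ultimately have GK: "(norm (G - K))\<^sup>2 \<le> \<delta>\<^sup>2 * (norm K)\<^sup>2"
    unfolding N_def[symmetric] using C(4) by (simp add: algebra_simps)
  define w where "w = (1 + \<delta>) *\<^sub>R K - G"
  define H where "H X = (1 + \<delta>) *\<^sub>R X - (inner w X / inner w K) *\<^sub>R w" for X
  note H = rank_one_update[OF \<delta>(1) GK, folded w_def, folded H_def[abs_def], folded H_def]
  define Ms where "Ms = (\<Sum>k<r. outer (z k) (z k))"
  define M where "M = (\<Sum>i<r. \<sigma> i *\<^sub>R outer (q i) (q i))"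
  \<comment> \<open>Centring at \<open>Ms\<close> makes that point critical with value 0, while the
    gradient at M is H K = G.\<close>
  define f where "f X = inner (H (X - Ms)) (X - Ms) / 2" for X :: "real^'n^'n"
  have f: "grad f X = H (X - Ms)" "hessian f X Y Y' = inner (H Y) Y'" "twice_continuously_differentiable f"
    for X Y Y'
    unfolding f_def[abs_def]
    by (rule grad_quadratic[OF H(1,2)], rule hessian_quadratic[OF H(1,2)],
        rule twice_continuously_differentiable_quadratic[OF H(1,2)])
  have K_eq: "K = M - Ms" by (simp add: K_def frame_difference_def M_def Ms_def)
  have sym_Ms: "transp Ms = Ms" by (simp add: Ms_def transp_sum transp_outer)
  have sym_K: "transp K = K"
    by (simp add: K_eq sym_Ms transp_diff M_def transp_sum transp_scaleR transp_outer)
  have sym_G: "transp G = G"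
    by (simp add: G_def frame_gradient_def transp_minus transp_sum transp_scaleR transp_outer)
  have sym_w: "transp w = w" by (simp add: w_def transp_diff transp_scaleR sym_K sym_G)
  \<comment> \<open>An explicit factor of \<open>Ms\<close>: it bounds the rank and shows that the
    value \<open>f Ms\<close> is attained by the factored objective.\<close>
  define Zm where "Zm = (\<Sum>k<r. outer (z k) (e k))"
  have Zm: "Zm ** transp Zm = Ms" unfolding Zm_def Ms_def by (rule sum_outer_mult_transp[OF e(1)])
  have sym_grad: "symmetric_matrix (grad f X)" if "symmetric_matrix X" for X
    using that by (simp add: f symmetric_matrix_def H_def transp_diff transp_scaleR sym_Ms sym_w)
  have adm: "admissible_objective CARD('r) f"
    unfolding admissible_objective_def
  proof (intro conjI exI[of _ Ms] allI impI)
    show "first_order_critical f Ms" using H(1) by (simp add: first_order_critical_def f linear_0)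
    show "symmetric_matrix Ms" using sym_Ms by (simp add: symmetric_matrix_def)
    then show "positive_semidefinite Ms"
    proof -
      have "inner x (Ms *v x) = (\<Sum>k<r. (inner (z k) x)\<^sup>2)" for x
        using sum_outer_mult_vec[of "\<lambda>_. 1" z z "{..<r}" x]
        by (simp add: Ms_def inner_sum_right power2_eq_square inner_commute)
      then show ?thesis
        using \<open>symmetric_matrix Ms\<close> by (simp add: positive_semidefinite_def sum_nonneg)
    qed
    show "rank Ms \<le> CARD('r)" using rank_gram[of Zm] by (simp add: Zm)
  qed (use f sym_grad in auto)
  have rip: "RIP \<delta> (2 * CARD('r)) (2 * CARD('r)) f" using H(4,5) by (simp add: RIP_def f)
  define U where "U = (\<Sum>k<r. outer (sqrt (\<sigma> k) *\<^sub>R q k) (e k))"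
  have "U ** transp U = (\<Sum>k<r. outer (sqrt (\<sigma> k) *\<^sub>R q k) (sqrt (\<sigma> k) *\<^sub>R q k))"
    unfolding U_def by (rule sum_outer_mult_transp[OF e(1)])
  also have "\<dots> = M" unfolding M_def
    by (intro sum.cong) (auto simp: outer_simps less_imp_le[OF C(3)])
  finally have UU: "U ** transp U = M" .
  have grad_M: "grad f M = G" using H(3) by (simp add: f K_eq)
  have Gq: "G *v q i = 0" if "i < r" for i
    unfolding G_def frame_gradient_mult_vec using orthonormal_onD[OF q] that by simp
  have "\<not> global_minimizer (factored f) U"
  proof
    assume "global_minimizer (factored f) U"
    then have "f M \<le> f Ms" unfolding global_minimizer_def factored_def UU using Zm by metis
    moreover have "f Ms = 0" using H(1) by (simp add: f_def linear_0)
    moreover have "f M = p / 2" using H(3) by (simp add: f_def p_def K_eq)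
    ultimately show False using \<open>p > 0\<close> by simp
  qed
  moreover have "grad (factored f) U = 0"
  proof -
    have "(G ** U) *v x = 0" for x
    proof -
      have "U *v x = (\<Sum>k<r. inner (e k) x *\<^sub>R sqrt (\<sigma> k) *\<^sub>R q k)"
        using sum_outer_mult_vec[of "\<lambda>_. 1" "\<lambda>k. sqrt (\<sigma> k) *\<^sub>R q k" e "{..<r}" x] by (simp add: U_def)
      then show ?thesis
        using Gq by (simp add: matrix_vector_mul_assoc[symmetric] linear_sum[OF matrix_vector_mul_linear]
            matrix_vector_mult_scaleR)
    qed
    then have "G ** U = 0" by (simp add: matrix_eq)
    then show ?thesis using grad_factored[OF f(3) sym_grad, of U] by (simp add: UU grad_M)
  qed
  moreover have "0 \<le> hessian (factored f) U V V" for V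
  proof -
    \<comment> \<open>The y_k are the columns of V relative to e. Each splits into u_k in the span
      of q_0, ..., q_(r-1) and y'_k orthogonal to it; correspondingly the tangent matrix splits into
      the diagonal block \<open>X u\<close> and the orthogonal off-diagonal part
      \<open>X y'\<close>.\<close>
    define y where "y k = V *v e k" for k
    define u where "u k = (\<Sum>i<r. inner (q i) (y k) *\<^sub>R q i)" for k
    define y' where "y' k = y k - u k" for k
    define s where "s k = sqrt (\<sigma> k)" for k
    define X where "X v = (\<Sum>k<r. s k *\<^sub>R (outer (q k) (v k) + outer (v k) (q k)))" for v
    have ss: "s k * s k = \<sigma> k" if "k < r" for k using C(3)[OF that] by (simp add: s_def)
    have V: "V = (\<Sum>k<r. outer (y k) (e k))"
    proof -
      have "V *v x = (\<Sum>k<r. outer (y k) (e k)) *v x" for x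
      proof -
        have x: "x = (\<Sum>k<r. inner (e k) x *\<^sub>R e k)"
          by (rule orthonormal_expand[OF e(1)]) (simp_all add: e(2))
        have "V *v x = (\<Sum>k<r. inner (e k) x *\<^sub>R y k)"
          by (subst x) (simp add: linear_sum[OF matrix_vector_mul_linear] matrix_vector_mult_scaleR y_def)
        then show ?thesis using sum_outer_mult_vec[of "\<lambda>_. 1" y e "{..<r}" x] by simp
      qed
      then show ?thesis by (simp add: matrix_eq)
    qed
    have UV: "U ** transp V = (\<Sum>k<r. outer (s k *\<^sub>R q k) (y k))"
      unfolding U_def s_def[symmetric] by (subst V) (rule sum_outer_mult_transp[OF e(1)])
    have VU: "V ** transp U = (\<Sum>k<r. outer (y k) (s k *\<^sub>R q k))"
      unfolding U_def s_def[symmetric] by (subst V) (rule sum_outer_mult_transp[OF e(1)])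
    have VV: "V ** transp V = (\<Sum>k<r. outer (y k) (y k))"
      by (subst (1 2) V) (rule sum_outer_mult_transp[OF e(1)])
    have "U ** transp V + V ** transp U = X y"
      by (simp add: UV VU X_def outer_simps sum.distrib scaleR_add_right)
    then have hess: "hessian (factored f) U V V = 2 * inner G (V ** transp V) + inner (H (X y)) (X y)"
      using hessian_factored[OF f(3) sym_grad, of U V] by (simp add: UU grad_M f(2))
    have y'q: "inner (q i) (y' k) = 0" if "i < r" for i k
    proof -
      have "inner (q i) (u k) = (\<Sum>j<r. if j = i then inner (q i) (y k) else 0)"
        unfolding u_def inner_sum_right using orthonormal_onD[OF q] that by (intro sum.cong) auto
      then show ?thesis using that by (simp add: y'_def inner_diff_right)
    qed
    have y'u: "inner (u k) (y' k') = 0" for k k'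
      by (simp add: u_def inner_sum_left y'q)
    have Xsplit: "X y = X u + X y'"
    proof -
      have "s k *\<^sub>R (outer (q k) (y k) + outer (y k) (q k)) =
          s k *\<^sub>R (outer (q k) (u k) + outer (u k) (q k)) +
          s k *\<^sub>R (outer (q k) (y' k) + outer (y' k) (q k))" for k
        by (simp add: y'_def outer_simps scaleR_add_right scaleR_diff_right)
      then show ?thesis unfolding X_def sum.distrib[symmetric] by (intro sum.cong refl)
    qed
    have XX: "inner (X v) (X v') = 2 * (\<Sum>k<r. \<Sum>k'<r. s k * s k' *
        (inner (q k) (q k') * inner (v k) (v' k') + inner (q k) (v' k') * inner (v k) (q k')))" for v v'
      unfolding X_def inner_sum_left unfolding inner_sum_right sum_distrib_left
      by (intro sum.cong refl) (simp add: inner_add_left inner_add_right inner_outer algebra_simps)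
    have cross: "inner (X u) (X y') = 0"
      unfolding XX by (simp add: y'u y'q)
    have norm_Xy': "inner (X y') (X y') = 2 * (\<Sum>k<r. \<sigma> k * (norm (y' k))\<^sup>2)"
    proof -
      have "(\<Sum>k'<r. s k * s k' * (inner (q k) (q k') * inner (y' k) (y' k') + inner (q k) (y' k') * inner (y' k) (q k')))
          = (\<Sum>k'<r. if k' = k then \<sigma> k * (norm (y' k))\<^sup>2 else 0)" if "k < r" for k
        using orthonormal_onD[OF q'] that
        by (intro sum.cong) (auto simp: y'q ss power2_norm_eq_inner)
      then show ?thesis unfolding XX by simp
    qed
    \<comment> \<open>G annihilates q_k, and M q_k has no component along y'. The component of
      \<open>Ms\<close> q_k along y' is a combination of entries of A C^T, hence zero.\<close>
    have w_cross: "inner w (X y') = 0"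
    proof -
      have Kq: "inner (y' k') (K *v q k) = 0" if k: "k < r" for k k'
      proof -
        have "inner (y' k') (K *v q k) = inner (y' k') (M *v q k) - inner (y' k') (Ms *v q k)"
          by (simp add: K_eq matrix_vector_mult_diff_rdistrib inner_diff_right)
        also have "inner (y' k') (M *v q k) = 0"
          by (simp add: M_def sum_outer_mult_vec inner_sum_right y'q inner_commute[of "y' k'"])
        also have "inner (y' k') (Ms *v q k) = (\<Sum>i<r. a k i * inner (y' k') (z i))"
          using sum_outer_mult_vec[of "\<lambda>_. 1" z z "{..<r}" "q k"] k
          by (simp add: Ms_def inner_sum_right inner_commute[of _ "q k"] qz)
        also have "\<dots> = (\<Sum>i<r. \<Sum>j<m. inner (y' k') (q (r + j)) * (a k i * c j i))"
          by (simp add: z_def inner_add_right inner_sum_right inner_commute[of "y' k'" "q _"] y'q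
              sum_distrib_left ac_simps)
        also have "\<dots> = (\<Sum>j<m. inner (y' k') (q (r + j)) * (\<Sum>i<r. a k i * c j i))"
          by (subst sum.swap) (simp add: sum_distrib_left)
        also have "\<dots> = 0" using ac[OF k] by simp
        finally show ?thesis by simp
      qed
      have wq: "inner (y' k') (w *v q k) = 0" if "k < r" for k k'
        using Kq[OF that] Gq[OF that]
        by (simp add: w_def matrix_vector_mult_diff_rdistrib scaleR_matrix_vector_assoc[symmetric])
      have "inner w (outer (q k) (y' k) + outer (y' k) (q k)) = 0" if "k < r" for k
        using wq[OF that] symmetric_matrix_inner[of w "q k" "y' k"] sym_w
        by (simp add: inner_add_right inner_matrix_outer symmetric_matrix_def inner_commute)
      then show ?thesis by (simp add: X_def inner_sum_right)
    qed
    \<comment> \<open>As w is orthogonal to \<open>X y'\<close>, the map H multiplies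
      \<open>X y'\<close> by 1 + \<delta>, and the mixed terms vanish.\<close>
    have "inner (H (X y)) (X y) = inner (H (X u)) (X u) + (1 + \<delta>) * inner (X y') (X y')"
      unfolding Xsplit H_def using w_cross cross
      by (simp add: inner_add_left inner_add_right inner_diff_left inner_commute algebra_simps)
    moreover have "0 \<le> inner (H (X u)) (X u)"
      using H(4)[of "X u"] \<delta> by (smt (verit) mult_nonneg_nonneg zero_le_power2)
    ultimately have HX: "2 * ((1 + \<delta>) * (\<Sum>k<r. \<sigma> k * (norm (y' k))\<^sup>2)) \<le> inner (H (X y)) (X y)"
      unfolding norm_Xy' by simp
    have "inner G (V ** transp V) = - (\<Sum>k<r. \<Sum>j<m. \<mu> j * (inner (q (r + j)) (y' k))\<^sup>2)"
    proof -
      have "inner (q (r + j)) (y k) = inner (q (r + j)) (y' k)" if "j < m" for j k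
      proof -
        have "inner (q (r + j)) (u k) = 0"
          unfolding u_def inner_sum_right using orthonormal_onD[OF q] that by (intro sum.neutral) auto
        then show ?thesis by (simp add: y'_def inner_diff_right)
      qed
      then show ?thesis
        by (simp add: VV inner_sum_right inner_matrix_outer G_def frame_gradient_mult_vec sum_negf
            inner_commute[of "y _" "q _"] power2_eq_square ac_simps)
    qed
    \<comment> \<open>The vector y'_k may leave the frame, so its frame coordinates are controlled
      by Bessel's inequality. A negative \<mu>_j is harmless, since only upper bounds on it
      enter.\<close>
    moreover have "(\<Sum>j<m. \<mu> j * (inner (q (r + j)) (y' k))\<^sup>2) \<le> (1 + \<delta>) * (\<sigma> k * (norm (y' k))\<^sup>2)"
      if k: "k < r" for k
    proof -
      have "(\<Sum>j<m. \<mu> j * (inner (q (r + j)) (y' k))\<^sup>2) \<le> (\<Sum>j<m. ((1 + \<delta>) * \<sigma> k) * (inner (q (r + j)) (y' k))\<^sup>2)"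
        using C(2)[OF k] by (intro sum_mono mult_right_mono) auto
      also have "\<dots> \<le> ((1 + \<delta>) * \<sigma> k) * (norm (y' k))\<^sup>2"
        unfolding sum_distrib_left[symmetric]
        using bessel_inequality[OF orthonormal_shift[OF q] finite_lessThan, of "y' k"] C(3)[OF k] \<delta>
        by (intro mult_left_mono) auto
      finally show ?thesis by (simp add: ac_simps)
    qed
    then have "(\<Sum>k<r. \<Sum>j<m. \<mu> j * (inner (q (r + j)) (y' k))\<^sup>2) \<le> (1 + \<delta>) * (\<Sum>k<r. \<sigma> k * (norm (y' k))\<^sup>2)"
      unfolding sum_distrib_left by (intro sum_mono) auto
    ultimately show ?thesis unfolding hess using HX by simp
  qed
  ultimately have "spurious_second_order_critical (factored f) U"
    by (simp add: spurious_second_order_critical_def second_order_critical_def)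
  with adm rip show ?thesis by blast
qed

theorem theorem5:
  fixes \<delta> :: real and l :: nat
  assumes "CARD('r::finite) \<le> CARD('n::finite)"
    and "l = min CARD('n) (2 * CARD('r))"
    and "0 \<le> \<delta>" and "\<delta> < 1"
  shows "((\<exists>f :: real^'n^'n \<Rightarrow> real.
             admissible_objective CARD('r) f \<and>
             RIP \<delta> (2 * CARD('r)) (2 * CARD('r)) f \<and>
             (\<exists>U :: real^'r^'n. spurious_second_order_critical (factored f) U))
          \<longrightarrow> (\<exists>\<alpha> S L A C. conditions CARD('r) l \<delta> \<alpha> S L A C))
       \<and> ((\<exists>\<alpha> S L A C. conditions CARD('r) l \<delta> \<alpha> S L A C \<and>
              A * C\<^sup>T = 0\<^sub>m CARD('r) (l - CARD('r)))
          \<longrightarrow> (\<exists>f :: real^'n^'n \<Rightarrow> real.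
             admissible_objective CARD('r) f \<and>
             RIP \<delta> (2 * CARD('r)) (2 * CARD('r)) f \<and>
             (\<exists>U :: real^'r^'n. spurious_second_order_critical (factored f) U)))"
  using necessity[OF assms] sufficiency[OF assms] by blast

end
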